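(* Let $F(z,w)=(f(z)-\delta w,z)$ be a transcendental Hénon map, and suppose the family $\{f_n\}_{n\in\mathbb N}$, $f_n(z)=f(nz)/n$, is quasi-normal on $\mathbb C$. Then $h_{\mathrm{top}}(\mathbb C^2,F)=+\infty$.
   Context: A transcendental Hénon map is $F(z,w)=(f(z)-\delta w,z)$ with $f$ transcendental entire and $\delta\ne0$. A family $\mathcal F$ of holomorphic functions on a domain $\Omega$ is quasi-normal if for every sequence in $\mathcal F$ there exist a finite set $Q\subset\Omega$ and a subsequence converging uniformly on compact subsets of $\Omega\setminus Q$ with respect to the spherical metric (limit $\equiv\infty$ allowed). Topological entropy: for a continuous self-map $g$ of a compact metric space $X$, $h_{\mathrm{top}}(X,g)=\sup_{\varepsilon>0}\limsup_n\frac1n\log K(n,\varepsilon)$, where $K(n,\varepsilon)$ is the maximal cardinality of a set $E$ such that any two distinct points $z,w\in E$ satisfy $d(g^k z,g^k w)>\varepsilon$ for some $0\le k\le n-1$; for a non-compact metric space $Y$, $h_{\mathrm{top}}(Y,g)$ is the supremum of $h_{\mathrm{top}}(X,g|_X)$ over compact $X\subset Y$ with $g(X)\subset X$ ($0$ if none). *)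

theory Defs
  imports "HOL-Complex_Analysis.Complex_Analysis"
begin

definition transcendental_entire :: "(complex \<Rightarrow> complex) \<Rightarrow> bool" where
  "transcendental_entire f \<longleftrightarrow> f holomorphic_on UNIV \<and> \<not> (\<exists>p. \<forall>z. f z = poly p z)"

definition henon_map :: "(complex \<Rightarrow> complex) \<Rightarrow> complex \<Rightarrow> complex \<times> complex \<Rightarrow> complex \<times> complex" where
  "henon_map f \<delta> = (\<lambda>(z, w). (f z - \<delta> * w, z))"

text \<open>Chordal (spherical) distance on the Riemann sphere; None stands for infinity.\<close>
fun chordal_dist :: "complex option \<Rightarrow> complex option \<Rightarrow> real" where
  "chordal_dist (Some a) (Some b) =
     2 * norm (a - b) / (sqrt (1 + (norm a)\<^sup>2) * sqrt (1 + (norm b)\<^sup>2))"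
| "chordal_dist (Some a) None = 2 / sqrt (1 + (norm a)\<^sup>2)"
| "chordal_dist None (Some b) = 2 / sqrt (1 + (norm b)\<^sup>2)"
| "chordal_dist None None = 0"

text \<open>Uniform convergence on compact subsets of U w.r.t. the spherical metric,
  to a limit h with values in the Riemann sphere (limit identically infinity allowed).\<close>
definition spherical_lu_conv ::
  "complex set \<Rightarrow> (nat \<Rightarrow> complex \<Rightarrow> complex) \<Rightarrow> (complex \<Rightarrow> complex option) \<Rightarrow> bool" where
  "spherical_lu_conv U g h \<longleftrightarrow>
     (\<forall>K. compact K \<and> K \<subseteq> U \<longrightarrow>
        (\<forall>e>0. eventually (\<lambda>k. \<forall>z\<in>K. chordal_dist (Some (g k z)) (h z) < e) sequentially))"

definition quasi_normal :: "complex set \<Rightarrow> (complex \<Rightarrow> complex) set \<Rightarrow> bool" where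
  "quasi_normal \<Omega> \<F> \<longleftrightarrow>
     (\<forall>g. (\<forall>k. g k \<in> \<F>) \<longrightarrow>
        (\<exists>Q r h. finite Q \<and> Q \<subseteq> \<Omega> \<and> strict_mono (r :: nat \<Rightarrow> nat) \<and> spherical_lu_conv (\<Omega> - Q) (g \<circ> r) h))"

definition separated_set :: "('a::metric_space \<Rightarrow> 'a) \<Rightarrow> nat \<Rightarrow> real \<Rightarrow> 'a set \<Rightarrow> bool" where
  "separated_set g n \<epsilon> E \<longleftrightarrow>
     (\<forall>x\<in>E. \<forall>y\<in>E. x \<noteq> y \<longrightarrow> (\<exists>k<n. dist ((g ^^ k) x) ((g ^^ k) y) > \<epsilon>))"

text \<open>Maximal cardinality of an (n,eps)-separated subset of X (finite for compact X).\<close>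
definition max_sep :: "'a::metric_space set \<Rightarrow> ('a \<Rightarrow> 'a) \<Rightarrow> nat \<Rightarrow> real \<Rightarrow> real" where
  "max_sep X g n \<epsilon> = Sup {real (card E) | E. finite E \<and> E \<subseteq> X \<and> separated_set g n \<epsilon> E}"

definition htop_compact :: "'a::metric_space set \<Rightarrow> ('a \<Rightarrow> 'a) \<Rightarrow> ereal" where
  "htop_compact X g = (SUP \<epsilon>\<in>{0<..}. limsup (\<lambda>n. ereal (ln (max_sep X g n \<epsilon>) / real n)))"

definition htop :: "'a::metric_space set \<Rightarrow> ('a \<Rightarrow> 'a) \<Rightarrow> ereal" where
  "htop Y g = Sup (insert 0 {htop_compact X g | X. compact X \<and> X \<subseteq> Y \<and> g ` X \<subseteq> X \<and> continuous_on X g})"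

end

(*
  By Picard, f takes some value c at infinitely many points. Choose points Z_k with f(Z_k) = c and
  |Z_k| -> infinity, put n_k = ceiling |Z_k|, and pass to a subsequence along which Z_k / n_k tends
  to a point zeta with |zeta| = 1 and f_{n_k} converges off a finite set Q. By Hurwitz the limit is
  either finite everywhere off Q or identically infinite; in the first case f grows at most linearly
  on the circles |z| = R n_k and is affine. Hence f_{n_k} tends to infinity off Q, in particular
  uniformly on the circles of a suitable small radius r about 0 and about zeta, while the discs that
  they bound contain respectively arbitrarily many points and at least one point of the fibre over c.

  So, in the scale n = n_k, f maps the discs B_0 = B(0, rn) and B_1 = B(n zeta, rn) in a proper way
  over a much larger disc. Orbits of the Henon map are the solutions of
  z_{k+1} + delta z_{k-1} = f(z_k). If z_{k-1} is close to b_{k-1} and z_{k+1} to b_{k+1}, where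
  each b_i is one of the two centres, then f(z_k) lies in a small disc about
  b_{k+1} + delta b_{k-1}, and z_k may be prescribed to lie in any component of the preimage
  of that disc: the open mapping theorem realises every such itinerary.

  It remains to find many components. Let V_0 and V_1 be disjoint discs and join a point over c in
  V_0 to V_1 by a segment free of critical values. It lifts to at least N arcs in B_0, N being the
  cardinality of the fibre, each running from a component over V_0 to a component over V_1. Two
  arcs with the same pair of components would close up to a loop in the preimage of the dumbbell
  formed by V_0, V_1 and the segment, but this compact set does not separate the plane. So the
  numbers of components over V_0 and over V_1 have product at least N, and one of them is at least
  sqrt N. With V_0 about 0 and V_1 about n zeta, the constant itinerary 0 0 0 ... or the periodic
  one 0 0 1 0 0 1 ... offers M >= sqrt N choices every third step.
*)
theory Submission
  imports Defs
begin

section \<open>Lower bounds for topological entropy\<close>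

text \<open>Each point of \<open>X\<close> has a neighbourhood whose points stay within
  \<open>\<epsilon> / 2\<close> of its orbit for \<open>n\<close> steps. Finitely many of these
  cover \<open>X\<close>, and each holds at most one point of a separated set. The bound makes the
  supremum in \<open>max_sep\<close> meaningful.\<close>

lemma separated_set_card_bounded:
  fixes g :: "'a::metric_space \<Rightarrow> 'a"
  assumes X: "compact X" "g ` X \<subseteq> X" "continuous_on X g" and "\<epsilon> > 0"
  shows "\<exists>B. \<forall>E. finite E \<and> E \<subseteq> X \<and> separated_set g n \<epsilon> E \<longrightarrow> real (card E) \<le> B"
proof -
  have inX: "(g ^^ k) ` X \<subseteq> X" for k
    using X(2) by (induction k) auto
  have cont: "continuous_on X (g ^^ k)" for k
  proof (induction k)
    case (Suc k)
    have "continuous_on X (g \<circ> (g ^^ k))"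
      by (intro continuous_on_compose Suc continuous_on_subset[OF X(3) inX])
    then show ?case by simp
  qed (simp add: id_def)
  have "\<exists>d>0. \<forall>y\<in>X. dist y x < d \<longrightarrow> (\<forall>k<n. dist ((g ^^ k) y) ((g ^^ k) x) < \<epsilon> / 2)"
    if "x \<in> X" for x
  proof -
    have "eventually (\<lambda>y. dist ((g ^^ k) y) ((g ^^ k) x) < \<epsilon> / 2) (at x within X)" for k
      using cont[of k] that \<open>\<epsilon> > 0\<close> by (intro tendstoD[of _ "(g ^^ k) x"]) (auto simp: continuous_on_def)
    then have "eventually (\<lambda>y. \<forall>k\<in>{..<n}. dist ((g ^^ k) y) ((g ^^ k) x) < \<epsilon> / 2) (at x within X)"
      by (intro eventually_ball_finite) auto
    then obtain d where "d > 0" and d: "\<forall>y\<in>X. y \<noteq> x \<and> dist y x < d \<longrightarrow>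
        (\<forall>k\<in>{..<n}. dist ((g ^^ k) y) ((g ^^ k) x) < \<epsilon> / 2)"
      unfolding eventually_at by blast
    have "\<forall>y\<in>X. dist y x < d \<longrightarrow> (\<forall>k<n. dist ((g ^^ k) y) ((g ^^ k) x) < \<epsilon> / 2)"
    proof (intro ballI impI allI)
      fix y k assume "y \<in> X" "dist y x < d" "k < n"
      then show "dist ((g ^^ k) y) ((g ^^ k) x) < \<epsilon> / 2"
        using d \<open>\<epsilon> > 0\<close> by (cases "y = x") auto
    qed
    then show ?thesis using \<open>d > 0\<close> by blast
  qed
  then obtain d where d: "\<And>x. x \<in> X \<Longrightarrow> d x > 0"
    "\<And>x y k. \<lbrakk>x \<in> X; y \<in> X; dist y x < d x; k < n\<rbrakk> \<Longrightarrow> dist ((g ^^ k) y) ((g ^^ k) x) < \<epsilon> / 2"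
    by metis
  obtain C where C: "C \<subseteq> X" "finite C" "X \<subseteq> (\<Union>x\<in>C. ball x (d x))"
  proof (rule compactE_image[OF X(1), of X "\<lambda>x. ball x (d x)"])
    show "X \<subseteq> (\<Union>x\<in>X. ball x (d x))" using d(1) by fastforce
  qed auto
  have "real (card E) \<le> real (card C)"
    if E: "finite E" "E \<subseteq> X" "separated_set g n \<epsilon> E" for E
  proof -
    have "\<forall>y\<in>E. \<exists>x\<in>C. dist y x < d x"
      using C(3) E(2) by (force simp: dist_commute)
    then obtain h where h: "\<And>y. y \<in> E \<Longrightarrow> h y \<in> C \<and> dist y (h y) < d (h y)"
      by metis
    have "inj_on h E"
    proof (rule inj_onI, rule ccontr)
      fix x y assume xy: "x \<in> E" "y \<in> E" "h x = h y" "x \<noteq> y"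
      then obtain k where k: "k < n" "dist ((g ^^ k) x) ((g ^^ k) y) > \<epsilon>"
        using E(3) unfolding separated_set_def by blast
      have "dist ((g ^^ k) x) ((g ^^ k) (h x)) < \<epsilon> / 2" "dist ((g ^^ k) y) ((g ^^ k) (h x)) < \<epsilon> / 2"
        using d(2) h xy C(1) E(2) k(1) by (metis subsetD)+
      then have "dist ((g ^^ k) x) ((g ^^ k) y) < \<epsilon>"
        by (rule dist_triangle_half_l)
      then show False using k(2) by simp
    qed
    then have "card E \<le> card C"
      using h C(2) by (intro card_inj_on_le[of h]) auto
    then show ?thesis by simp
  qed
  then show ?thesis by blast
qed

lemma card_le_max_sep:
  fixes g :: "'a::metric_space \<Rightarrow> 'a"
  assumes "compact X" "g ` X \<subseteq> X" "continuous_on X g" "\<epsilon> > 0"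
    and "finite E" "E \<subseteq> X" "separated_set g n \<epsilon> E"
  shows "real (card E) \<le> max_sep X g n \<epsilon>"
  unfolding max_sep_def
proof (rule cSup_upper)
  show "bdd_above {real (card E) |E. finite E \<and> E \<subseteq> X \<and> separated_set g n \<epsilon> E}"
    using separated_set_card_bounded[OF assms(1-4), of n] by (auto simp: bdd_above_def)
qed (use assms in auto)

text \<open>Along the times \<open>p * j\<close> with \<open>j > 0\<close> the quotient in the
  entropy is at least \<open>ln (M ^ j) / (p * j)\<close>, which does not depend on
  \<open>j\<close>, and the limsup dominates such a subsequence.\<close>

lemma htop_ge:
  fixes g :: "'a::metric_space \<Rightarrow> 'a"
  assumes X: "compact X" "X \<subseteq> Y" "g ` X \<subseteq> X" "continuous_on X g" and "\<epsilon> > 0" "p > 0" "M > 0"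
    and sep: "\<And>j. \<exists>E. finite E \<and> E \<subseteq> X \<and> separated_set g (p * j) \<epsilon> E \<and> card E \<ge> M ^ j"
  shows "htop Y g \<ge> ereal (ln (real M) / real p)"
proof -
  let ?a = "\<lambda>n. ereal (ln (max_sep X g n \<epsilon>) / real n)"
  have 1: "ereal (ln (real M) / real p) \<le> ?a (p * j)" if "j > 0" for j
  proof -
    obtain E where E: "finite E" "E \<subseteq> X" "separated_set g (p * j) \<epsilon> E" "card E \<ge> M ^ j"
      using sep by blast
    have "real M ^ j \<le> real (card E)"
      using E(4) by (metis of_nat_le_iff of_nat_power)
    also have "\<dots> \<le> max_sep X g (p * j) \<epsilon>"
      using X E by (intro card_le_max_sep \<open>\<epsilon> > 0\<close>)
    finally have "ln (real M ^ j) \<le> ln (max_sep X g (p * j) \<epsilon>)"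
      using \<open>M > 0\<close> by (meson ln_mono of_nat_0_less_iff zero_less_power)
    then have "real j * ln (real M) \<le> ln (max_sep X g (p * j) \<epsilon>)"
      using \<open>M > 0\<close> by (simp add: ln_realpow)
    then show ?thesis
      using that \<open>p > 0\<close> by (simp add: field_simps)
  qed
  have "ereal (ln (real M) / real p) \<le> limsup ?a"
    unfolding limsup_INF_SUP
  proof (rule INF_greatest)
    fix n
    have "ereal (ln (real M) / real p) \<le> ?a (p * Suc n)"
      by (rule 1) simp
    also have "p * Suc n \<ge> n"
      using \<open>p > 0\<close> by (cases p) auto
    then have "?a (p * Suc n) \<le> (SUP m\<in>{n..}. ?a m)"
      by (intro SUP_upper) simp
    finally show "ereal (ln (real M) / real p) \<le> (SUP m\<in>{n..}. ?a m)" .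
  qed
  also have "\<dots> \<le> htop_compact X g"
    unfolding htop_compact_def using \<open>\<epsilon> > 0\<close> by (intro SUP_upper2[of \<epsilon>]) auto
  also have "\<dots> \<le> htop Y g"
    unfolding htop_def using X by (intro Sup_upper) blast
  finally show ?thesis .
qed

section \<open>Realising itineraries of Henon maps\<close>

text \<open>A clopen argument in the connected ball: the trace of the image on it is closed because
  frontier values avoid the ball, and open by the open mapping theorem.\<close>

lemma ball_subset_holomorphic_image:
  assumes W: "open W" "bounded W" and g: "g holomorphic_on W" "continuous_on (closure W) g"
    and t: "t \<in> W" "g t \<in> ball b R" and fr: "\<And>x. x \<in> frontier W \<Longrightarrow> g x \<notin> ball b R"
  shows "ball b R \<subseteq> g ` W"
proof -
  let ?T = "g ` W \<inter> ball b R"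
  have cW: "closure W = W \<union> frontier W"
    by (simp add: closure_Un_frontier)
  have "compact (g ` closure W)"
    using W g by (intro compact_continuous_image) auto
  then have "closed (g ` closure W)" by (rule compact_imp_closed)
  moreover have "?T = ball b R \<inter> g ` closure W"
    using fr cW by auto
  ultimately have 1: "closedin (top_of_set (ball b R)) ?T"
    by (metis closedin_closed_Int)
  have "\<exists>S. open S \<and> y \<in> S \<and> S \<subseteq> g ` W" if "y \<in> ?T" for y
  proof -
    have "y \<in> g ` W" "y \<in> ball b R" using that by blast+
    then obtain x where x: "x \<in> W" "y = g x" "g x \<in> ball b R" by blast
    let ?C = "connected_component_set W x"
    have C: "open ?C" "connected ?C" "?C \<subseteq> W" "x \<in> ?C" "?C \<in> components W"
      using x W by (auto simp: open_connected_component connected_component_subset componentsI)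
    \<comment> \<open>A constant value on the component would persist to its frontier, which is part
      of the frontier of \<open>W\<close>, and hence lie outside the ball.\<close>
    have "\<not> g constant_on ?C"
    proof
      assume "g constant_on ?C"
      then have const: "\<And>z. z \<in> ?C \<Longrightarrow> g z = g x"
        using C(4) by (metis constant_on_def)
      have "frontier ?C \<noteq> {}"
        using C(3,4) W(2) by (metis bounded_subset empty_iff frontier_not_empty not_bounded_UNIV)
      then obtain z where z: "z \<in> frontier ?C" by blast
      then have "z \<in> frontier W"
        using frontier_of_components_subset[OF C(5)] by blast
      have "g z = g x"
      proof (rule continuous_constant_on_closure[of ?C g])
        show "continuous_on (closure ?C) g"
          using continuous_on_subset[OF g(2)] C(3) closure_mono by blast
        show "z \<in> closure ?C" using z by (simp add: frontier_def)
      qed (use const in auto)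
      then show False using fr[OF \<open>z \<in> frontier W\<close>] x(3) by simp
    qed
    then have "open (g ` ?C)"
      using C g by (intro open_mapping_thm[of g ?C]) (auto intro: holomorphic_on_subset)
    then show ?thesis using C x by blast
  qed
  then have "openin (top_of_set (ball b R)) ?T"
    unfolding openin_open
  proof -
    assume "\<And>y. y \<in> ?T \<Longrightarrow> \<exists>S. open S \<and> y \<in> S \<and> S \<subseteq> g ` W"
    then obtain S where S: "\<And>y. y \<in> ?T \<Longrightarrow> open (S y) \<and> y \<in> S y \<and> S y \<subseteq> g ` W"
      by metis
    then show "\<exists>T. open T \<and> ?T = ball b R \<inter> T"
      by (intro exI[of _ "\<Union>y\<in>?T. S y"]) blast
  qed
  then have "?T = {} \<or> ?T = ball b R"
    using 1 connected_clopen[of "ball b R"] by auto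
  then show ?thesis using t by blast
qed

text \<open>The first coordinates along the orbit of \<open>(t, w)\<close>, shifted by one: index 0 is the initial second
  coordinate \<open>w\<close>, index 1 the initial first coordinate \<open>t\<close>.\<close>
fun henon_orbit :: "(complex \<Rightarrow> complex) \<Rightarrow> complex \<Rightarrow> complex \<Rightarrow> nat \<Rightarrow> complex \<Rightarrow> complex" where
  "henon_orbit f \<delta> w 0 t = w"
| "henon_orbit f \<delta> w (Suc 0) t = t"
| "henon_orbit f \<delta> w (Suc (Suc k)) t = f (henon_orbit f \<delta> w (Suc k) t) - \<delta> * henon_orbit f \<delta> w k t"

lemma funpow_henon_map:
  "(henon_map f \<delta> ^^ k) (t, w) = (henon_orbit f \<delta> w (Suc k) t, henon_orbit f \<delta> w k t)"
  by (induction k) (auto simp: henon_map_def)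

lemma holomorphic_on_entire_compose:
  assumes "f holomorphic_on UNIV" "g holomorphic_on A"
  shows "(\<lambda>z. f (g z)) holomorphic_on A"
  using holomorphic_on_compose[OF assms(2) holomorphic_on_subset[OF assms(1)]] by (simp add: o_def)

lemma henon_orbit_holomorphic:
  assumes "f holomorphic_on UNIV"
  shows "henon_orbit f \<delta> w k holomorphic_on A"
proof -
  have "(\<lambda>t. henon_orbit f \<delta> w k t) holomorphic_on A \<and> (\<lambda>t. henon_orbit f \<delta> w (Suc k) t) holomorphic_on A"
    by (induction k)
      (auto intro!: holomorphic_intros holomorphic_on_entire_compose[OF assms])
  then show ?thesis by simp
qed

text \<open>Together with the openness of \<open>f\<close>, the condition on the frontier makes \<open>f\<close> map \<open>U\<close> over the whole
  disc \<open>ball c v\<close>. The degree may be larger than 1 and \<open>U\<close> need not be connected.\<close>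
definition island :: "(complex \<Rightarrow> complex) \<Rightarrow> complex set \<Rightarrow> complex \<Rightarrow> real \<Rightarrow> bool" where
  "island f U c v \<longleftrightarrow> open U \<and> bounded U \<and> c \<in> f ` U \<and> (\<forall>z\<in>frontier U. v \<le> cmod (f z - c))"

text \<open>The initial values that follow the itinerary up to time \<open>k\<close> form nested
  open sets, each mapped over the next island; compactness yields a value common to all. The factor
  in \<open>v\<close> leaves room for the radius of the next disc and for the error made by
  replacing the previous position by its centre.\<close>

lemma henon_itinerary:
  assumes f: "f holomorphic_on UNIV" and "\<rho> > 0" and v: "v \<ge> 2 * (1 + cmod \<delta>) * \<rho>"
    and U: "\<And>k. island f (U (Suc k)) (b (Suc (Suc k)) + \<delta> * b k) v"
    and Ub: "\<And>k. U (Suc k) \<subseteq> ball (b (Suc k)) \<rho>"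
  shows "\<exists>t. \<forall>k. henon_orbit f \<delta> (b 0) (Suc k) t \<in> U (Suc k)"
proof -
  let ?Z = "henon_orbit f \<delta> (b 0)"
  \<comment> \<open>On the frontier of \<open>W k\<close> the value \<open>f (?Z (Suc k) t)\<close> is so far from the centre of its disc that
    \<open>?Z (Suc (Suc k))\<close> leaves the next disc; hence it maps \<open>W k\<close> over that disc.\<close>
  define W where "W k = {t. \<forall>j\<le>k. ?Z (Suc j) t \<in> U (Suc j)}" for k
  have hol: "?Z k holomorphic_on A" for k A
    by (rule henon_orbit_holomorphic[OF f])
  have cont: "continuous_on A (?Z k)" for k A
    by (rule holomorphic_on_imp_continuous_on[OF hol])
  have WSuc: "W (Suc k) = W k \<inter> ?Z (Suc (Suc k)) -` U (Suc (Suc k))" for k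
    by (auto simp: W_def le_Suc_eq)
  have W0: "W 0 = U (Suc 0)"
    by (auto simp: W_def)
  have opU: "open (U (Suc k))" for k
    using U by (simp add: island_def)
  have opW: "open (W k)" for k
  proof (induction k)
    case (Suc k)
    then show ?case
      unfolding WSuc by (intro open_Int open_vimage opU cont)
  qed (simp add: W0 opU)
  have WU: "W k \<subseteq> U (Suc 0)" for k
    by (auto simp: W_def)
  have bdW: "bounded (W k)" for k
    using WU Ub[of 0] bounded_ball bounded_subset by metis
  have clU: "closure (U (Suc k)) \<subseteq> cball (b (Suc k)) \<rho>" for k
    using Ub closure_mono[OF Ub] by (metis \<open>\<rho> > 0\<close> closure_ball)
  have clZ: "?Z (Suc k) t \<in> closure (U (Suc k))" if "t \<in> closure (W k)" for t k
  proof -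
    have "?Z (Suc k) ` closure (W k) \<subseteq> closure (U (Suc k))"
      by (rule image_closure_subset[OF cont]) (auto simp: W_def intro: closure_subset[THEN subsetD])
    then show ?thesis using that by blast
  qed
  have clZ': "?Z k t \<in> cball (b k) \<rho>" if "t \<in> closure (W k)" for t k
  proof (cases k)
    case 0
    then show ?thesis using \<open>\<rho> > 0\<close> by simp
  next
    case (Suc j)
    have "closure (W k) \<subseteq> closure (W j)"
      by (rule closure_mono) (simp add: Suc WSuc)
    then show ?thesis using clZ[of t j] clU[of j] that Suc by blast
  qed
  have "?Z (Suc k) ` W k = U (Suc k) \<and> (\<forall>t\<in>frontier (W k). ?Z (Suc k) t \<in> frontier (U (Suc k)))
        \<and> closure (W (Suc k)) \<subseteq> W k" for k
  proof -
    \<comment> \<open>What remains of \<open>v\<close> after replacing the previous position by its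
      centre, at a cost of at most \<open>cmod \<delta> * \<rho>\<close>; it still exceeds
      \<open>\<rho>\<close>.\<close>
    define R where "R = v - cmod \<delta> * \<rho>"
    have R: "R \<ge> (2 + cmod \<delta>) * \<rho>"
      using v by (simp add: R_def algebra_simps)
    have "cmod \<delta> * \<rho> \<ge> 0" using \<open>\<rho> > 0\<close> by simp
    then have R': "\<rho> < R" "cmod \<delta> * \<rho> < R"
      using R \<open>\<rho> > 0\<close> unfolding distrib_right by linarith+
    have *: "(\<forall>t\<in>frontier (W k). ?Z (Suc (Suc k)) t \<notin> ball (b (Suc (Suc k))) R) \<and>
             ball (b (Suc (Suc k))) R \<subseteq> ?Z (Suc (Suc k)) ` W k"
      if IH: "?Z (Suc k) ` W k = U (Suc k)" "\<forall>t\<in>frontier (W k). ?Z (Suc k) t \<in> frontier (U (Suc k))" for k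
    proof -
      let ?b = "b (Suc (Suc k))"
      have 1: "?Z (Suc (Suc k)) t - ?b = (f (?Z (Suc k) t) - (?b + \<delta> * b k)) - \<delta> * (?Z k t - b k)" for t
        by (simp add: algebra_simps)
      have 2: "cmod (\<delta> * (?Z k t - b k)) \<le> cmod \<delta> * \<rho>" if "t \<in> closure (W k)" for t
        using clZ'[OF that] by (auto simp: norm_mult dist_norm norm_minus_commute intro!: mult_left_mono)
      have fr: "?Z (Suc (Suc k)) t \<notin> ball ?b R" if "t \<in> frontier (W k)" for t
      proof -
        have "v \<le> cmod (f (?Z (Suc k) t) - (?b + \<delta> * b k))"
          using IH(2) that U[of k] by (auto simp: island_def)
        moreover have "cmod (\<delta> * (?Z k t - b k)) \<le> cmod \<delta> * \<rho>"
          using that by (intro 2) (simp add: frontier_def)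
        ultimately have "R \<le> cmod (?Z (Suc (Suc k)) t - ?b)"
          unfolding 1 R_def using norm_triangle_ineq2[of "f (?Z (Suc k) t) - (?b + \<delta> * b k)" "\<delta> * (?Z k t - b k)"]
          by linarith
        then show ?thesis by (simp add: dist_norm norm_minus_commute)
      qed
      \<comment> \<open>Where \<open>f\<close> hits the centre of its disc, the next position is off
        by at most \<open>cmod \<delta> * \<rho>\<close>. So the ball is met, and avoidance on the
        frontier makes it covered.\<close>
      obtain t where t: "t \<in> W k" "f (?Z (Suc k) t) = ?b + \<delta> * b k"
        using U[of k] IH(1) unfolding island_def by (metis (no_types, lifting) imageE)
      have "cmod (?Z (Suc (Suc k)) t - ?b) \<le> cmod \<delta> * \<rho>"
        unfolding 1 using 2[of t] t closure_subset by (auto simp: norm_minus_commute)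
      also have "\<dots> < R" by (rule R')
      finally have "?Z (Suc (Suc k)) t \<in> ball ?b R"
        by (simp add: dist_norm norm_minus_commute)
      then show ?thesis
        using fr ball_subset_holomorphic_image[OF opW bdW hol cont t(1) _ fr] by metis
    qed
    \<comment> \<open>On \<open>closure (W (Suc k))\<close> the next position is within
      \<open>\<rho> < R\<close> of its centre, which is impossible on the frontier of
      \<open>W k\<close>.\<close>
    have nest: "closure (W (Suc k)) \<subseteq> W k"
      if "\<forall>t\<in>frontier (W k). ?Z (Suc (Suc k)) t \<notin> ball (b (Suc (Suc k))) R" for k
    proof
      fix t assume t: "t \<in> closure (W (Suc k))"
      then have "t \<in> closure (W k)" using closure_mono[of "W (Suc k)" "W k"] WSuc by blast
      moreover have "?Z (Suc (Suc k)) t \<in> cball (b (Suc (Suc k))) \<rho>"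
        using clZ[OF t] clU by blast
      then have "?Z (Suc (Suc k)) t \<in> ball (b (Suc (Suc k))) R"
        using R' by simp
      ultimately show "t \<in> W k" using that opW
        by (metis DiffI frontier_def interior_open)
    qed
    have "?Z (Suc k) ` W k = U (Suc k) \<and> (\<forall>t\<in>frontier (W k). ?Z (Suc k) t \<in> frontier (U (Suc k)))"
    proof (induction k)
      case 0
      then show ?case by (simp add: W0)
    next
      case (Suc k)
      note S = *[OF Suc[THEN conjunct1] Suc[THEN conjunct2]]
      have "U (Suc (Suc k)) \<subseteq> ball (b (Suc (Suc k))) R"
        using Ub[of "Suc k"] subset_ball[of \<rho> R] R' by fastforce
      then have "?Z (Suc (Suc k)) ` W (Suc k) = U (Suc (Suc k))"
        using S[THEN conjunct2] unfolding WSuc by (auto simp del: mem_ball henon_orbit.simps)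
      moreover have "?Z (Suc (Suc k)) t \<in> frontier (U (Suc (Suc k)))" if t: "t \<in> frontier (W (Suc k))" for t
      proof -
        have t': "t \<in> closure (W (Suc k))" "t \<notin> W (Suc k)"
          using t opW by (auto simp: frontier_def interior_open)
        then have "t \<in> W k" using nest[OF S[THEN conjunct1]] by blast
        then have "?Z (Suc (Suc k)) t \<notin> U (Suc (Suc k))" using t'(2) by (simp add: WSuc)
        then show ?thesis using clZ[OF t'(1)] opU by (simp add: frontier_def interior_open)
      qed
      ultimately show ?case by blast
    qed
    note A = this
    have "\<forall>t\<in>frontier (W k). ?Z (Suc (Suc k)) t \<notin> ball (b (Suc (Suc k))) R"
      by (rule *[OF A[THEN conjunct1] A[THEN conjunct2], THEN conjunct1])
    from nest[OF this] A show ?thesis by (intro conjI) auto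
  qed
  note inv = this
  \<comment> \<open>Each closure lies in the previous open set, so a point common to the closures
    belongs to every \<open>W k\<close>.\<close>
  have "(\<Inter>k. closure (W k)) \<noteq> {}"
  proof (rule compact_nest)
    show "compact (closure (W k))" for k using bdW by simp
    show "closure (W k) \<noteq> {}" for k
      using inv[of k] U[of k] by (auto simp: island_def)
    show "closure (W n) \<subseteq> closure (W m)" if "m \<le> n" for m n
      using that by (intro closure_mono) (auto simp: W_def)
  qed
  then obtain t where "\<And>k. t \<in> closure (W k)" by blast
  then have "t \<in> W k" for k using inv by blast
  then show ?thesis unfolding W_def by blast
qed

section \<open>Entropy from itineraries through disjoint islands\<close>

text \<open>Provides a single scale \<open>\<epsilon>\<close> at which itineraries with different
  symbols are told apart: disjoint compact sets have positive distance, and there are finitely many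
  pairs.\<close>

lemma finite_disjoint_compact_separated:
  fixes K :: "nat \<Rightarrow> 'a::heine_borel set"
  assumes "\<And>i. i < M \<Longrightarrow> compact (K i)" "\<And>i j. \<lbrakk>i < M; j < M; i \<noteq> j\<rbrakk> \<Longrightarrow> K i \<inter> K j = {}"
  shows "\<exists>\<epsilon>>0. \<forall>i<M. \<forall>j<M. i \<noteq> j \<longrightarrow> (\<forall>x\<in>K i. \<forall>y\<in>K j. \<epsilon> < dist x y)"
proof -
  have "\<exists>d>0. i < M \<longrightarrow> j < M \<longrightarrow> i \<noteq> j \<longrightarrow> (\<forall>x\<in>K i. \<forall>y\<in>K j. d \<le> dist x y)" for i j
  proof (cases "i < M \<and> j < M \<and> i \<noteq> j")
    case True
    then show ?thesis
      using separate_compact_closed[of "K i" "K j"] assms compact_imp_closed by metis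
  qed (auto intro: exI[of _ 1])
  then obtain d where d: "\<And>i j. d i j > 0"
    "\<And>i j x y. \<lbrakk>i < M; j < M; i \<noteq> j; x \<in> K i; y \<in> K j\<rbrakk> \<Longrightarrow> d i j \<le> dist x y"
    by metis
  \<comment> \<open>The entry 1 keeps the minimum defined when \<open>M = 0\<close>; half the
    minimum then gives the strict inequality.\<close>
  let ?D = "insert (1::real) ((\<lambda>(i, j). d i j) ` ({..<M} \<times> {..<M}))"
  have fin: "finite ?D" by simp
  have pos: "Min ?D > 0" using d(1) fin by (subst Min_gr_iff) auto
  have le: "Min ?D \<le> d i j" if "i < M" "j < M" for i j
    using that by (intro Min_le[OF fin]) force
  have "Min ?D / 2 < dist x y" if "i < M" "j < M" "i \<noteq> j" "x \<in> K i" "y \<in> K j" for i j x y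
    using le[OF that(1,2)] d(2)[OF that] pos by linarith
  then show ?thesis using pos by (intro exI[of _ "Min ?D / 2"]) auto
qed

lemma henon_map_continuous:
  assumes "f holomorphic_on UNIV"
  shows "continuous_on A (henon_map f \<delta>)"
proof -
  have "continuous_on UNIV f" using assms by (rule holomorphic_on_imp_continuous_on)
  then have "continuous_on A (\<lambda>p. f (fst p))"
    by (rule continuous_on_compose2) (auto intro!: continuous_intros)
  then show ?thesis
    unfolding henon_map_def case_prod_beta by (intro continuous_intros)
qed

text \<open>The centres are \<open>0, 0, b, 0, 0, b, \<dots>\<close>; only the first position after a multiple of 3 offers a choice.\<close>
lemma htop_henon_ge_islands:
  assumes f: "f holomorphic_on UNIV" and "\<rho> > 0" and v: "v \<ge> 2 * (1 + cmod \<delta>) * \<rho>" and "M > 0"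
    and U: "\<And>i. i < M \<Longrightarrow> island f (U i) b v \<and> U i \<subseteq> ball 0 \<rho>"
    and disj: "\<And>i j. \<lbrakk>i < M; j < M; i \<noteq> j\<rbrakk> \<Longrightarrow> U i \<inter> U j = {}"
    and V: "island f V 0 v" "V \<subseteq> ball b \<rho>"
    and V': "island f V' (\<delta> * b) v" "V' \<subseteq> ball 0 \<rho>"
  shows "htop (UNIV :: (complex \<times> complex) set) (henon_map f \<delta>) \<ge> ereal (ln (real M) / real 3)"
proof -
  define F where "F = henon_map f \<delta>"
  define c where "c k = (if k mod 3 = 2 then b else 0)" for k :: nat
  define R where "R = cmod b + \<rho>"
  \<comment> \<open>Points whose whole forward orbit stays in a bidisc: a compact forward invariant
    set, large enough for all the itineraries below.\<close>
  define X where "X = {p. \<forall>k. (F ^^ k) p \<in> cball 0 R \<times> cball 0 R}"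
  have contF: "continuous_on A F" for A
    unfolding F_def by (rule henon_map_continuous[OF f])
  have contFk: "continuous_on UNIV (F ^^ k)" for k
  proof (induction k)
    case (Suc k)
    have "continuous_on UNIV (F \<circ> (F ^^ k))"
      by (intro continuous_on_compose Suc contF)
    then show ?case by simp
  qed (simp add: id_def)
  have "closed X"
  proof -
    have "X = (\<Inter>k. (F ^^ k) -` (cball 0 R \<times> cball 0 R))" by (auto simp: X_def)
    moreover have "closed ((F ^^ k) -` (cball 0 R \<times> cball 0 R))" for k
      using contFk by (intro closed_vimage closed_Times) auto
    ultimately show ?thesis by auto
  qed
  moreover have "X \<subseteq> cball 0 R \<times> cball 0 R"
  proof
    fix p assume "p \<in> X"
    then have "(F ^^ 0) p \<in> cball 0 R \<times> cball 0 R" unfolding X_def by blast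
    then show "p \<in> cball 0 R \<times> cball 0 R" by simp
  qed
  then have "bounded X" by (rule bounded_subset[rotated]) (intro bounded_Times bounded_cball)
  ultimately have cX: "compact X" by (simp add: compact_eq_bounded_closed)
  have FX: "F ` X \<subseteq> X"
  proof
    fix q assume "q \<in> F ` X"
    then obtain p where p: "p \<in> X" "q = F p" by blast
    have "\<forall>k. (F ^^ k) p \<in> cball 0 R \<times> cball 0 R"
      using p(1) unfolding X_def by (rule CollectD)
    then have "(F ^^ Suc k) p \<in> cball 0 R \<times> cball 0 R" for k
      by (rule spec)
    then have "(F ^^ k) q \<in> cball 0 R \<times> cball 0 R" for k
      by (simp only: p funpow_Suc_right o_apply)
    then show "q \<in> X" unfolding X_def by (intro CollectI allI)
  qed
  \<comment> \<open>Disjoint open islands may touch, so separation is measured on these compact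
    cores. A prescribed orbit has its next position near \<open>b\<close> and its previous one near
    0, which puts it in the core.\<close>
  define K where "K i = closure (U i) \<inter> f -` cball b ((1 + cmod \<delta>) * \<rho>)" for i
  have vr: "(1 + cmod \<delta>) * \<rho> < v"
  proof -
    have "(1 + cmod \<delta>) * \<rho> > 0" using \<open>\<rho> > 0\<close> by (intro mult_pos_pos) (auto intro: add_pos_nonneg)
    then show ?thesis using v by linarith
  qed
  have contf: "continuous_on A f" for A
    using f by (meson holomorphic_on_imp_continuous_on holomorphic_on_subset subset_UNIV)
  have KU: "K i \<subseteq> U i" if "i < M" for i
  proof
    fix z assume z: "z \<in> K i"
    show "z \<in> U i"
    proof (rule ccontr)
      assume "z \<notin> U i"
      then have "z \<in> frontier (U i)" using z U[OF that] by (auto simp: K_def frontier_def island_def interior_open)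
      then have "v \<le> cmod (f z - b)" using U[OF that] by (simp add: island_def)
      then show False using z vr by (simp add: K_def dist_norm norm_minus_commute)
    qed
  qed
  have compK: "compact (K i)" if "i < M" for i
    unfolding K_def using U[OF that] contf
    by (intro compact_Int_closed closed_vimage) (auto simp: island_def)
  have disjK: "K i \<inter> K j = {}" if "i < M" "j < M" "i \<noteq> j" for i j
    using disj[OF that] KU[OF that(1)] KU[OF that(2)] by blast
  obtain \<epsilon> where \<epsilon>: "\<epsilon> > 0"
    "\<And>i j x y. \<lbrakk>i < M; j < M; i \<noteq> j; x \<in> K i; y \<in> K j\<rbrakk> \<Longrightarrow> \<epsilon> < dist x y"
    using finite_disjoint_compact_separated[of M K, OF compK disjK] by blast
  have itin: "\<exists>t. (t, 0) \<in> X \<and> (\<forall>i. fst ((F ^^ (3 * i)) (t, 0)) \<in> K (s i))"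
    if s: "\<And>i. s i < M" for s :: "nat \<Rightarrow> nat"
  proof -
    \<comment> \<open>Position \<open>k\<close> is near \<open>c k\<close>, and its image must be
      near \<open>c (k + 1) + \<delta> * c (k - 1)\<close>; these targets are \<open>b\<close>, 0
      and \<open>\<delta> * b\<close> for \<open>k mod 3\<close> equal to 1, 2 and 0. Orbit time
      \<open>3 * i\<close> is position \<open>3 * i + 1\<close>, owing to the shift in
      \<open>henon_orbit\<close>.\<close>
    define P where "P k = (if k mod 3 = 1 then U (s (k div 3)) else if k mod 3 = 2 then V else V')" for k
    have "island f (P (Suc k)) (c (Suc (Suc k)) + \<delta> * c k) v \<and> P (Suc k) \<subseteq> ball (c (Suc k)) \<rho>" for k
    proof -
      consider "k mod 3 = 0" | "k mod 3 = 1" | "k mod 3 = 2" by linarith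
      then show ?thesis
      proof cases
        case 1
        then have "Suc k mod 3 = 1" "Suc (Suc k) mod 3 = 2" by presburger+
        then show ?thesis using 1 U[OF s] by (simp add: P_def c_def)
      next
        case 2
        then have "Suc k mod 3 = 2" "Suc (Suc k) mod 3 = 0" by presburger+
        then show ?thesis using 2 V by (simp add: P_def c_def)
      next
        case 3
        then have "Suc k mod 3 = 0" "Suc (Suc k) mod 3 = 1" by presburger+
        then show ?thesis using 3 V' by (simp add: P_def c_def)
      qed
    qed
    note P = this
    obtain t where t: "\<And>k. henon_orbit f \<delta> (c 0) (Suc k) t \<in> P (Suc k)"
      using henon_itinerary[OF f \<open>\<rho> > 0\<close> v, of P c] P by blast
    let ?Z = "\<lambda>k. henon_orbit f \<delta> (c 0) k t"
    have c0: "c 0 = 0" by (simp add: c_def)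
    have Zc: "cmod (?Z k - c k) < \<rho>" for k
    proof (cases k)
      case 0
      then show ?thesis using \<open>\<rho> > 0\<close> by simp
    next
      case (Suc j)
      then show ?thesis using t[of j] P[of j] by (auto simp: dist_norm norm_minus_commute subset_iff)
    qed
    have "cmod (?Z k) \<le> R" for k
    proof -
      have "cmod (c k) \<le> cmod b" by (simp add: c_def)
      then show ?thesis using Zc[of k] norm_triangle_sub[of "?Z k" "c k"] unfolding R_def by linarith
    qed
    moreover have Fk: "(F ^^ k) (t, 0) = (?Z (Suc k), ?Z k)" for k
      unfolding F_def c0 by (rule funpow_henon_map)
    ultimately have "(t, 0) \<in> X"
      by (simp add: X_def del: henon_orbit.simps)
    moreover have "fst ((F ^^ (3 * i)) (t, 0)) \<in> K (s i)" for i
    proof -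
      let ?k = "3 * i"
      have 1: "fst ((F ^^ ?k) (t, 0)) = ?Z (Suc ?k)"
        by (simp only: Fk fst_conv)
      have "Suc ?k mod 3 = 1" "Suc ?k div 3 = i" by presburger+
      then have "?Z (Suc ?k) \<in> U (s i)" using t[of ?k] by (simp add: P_def)
      moreover have "cmod (f (?Z (Suc ?k)) - b) \<le> (1 + cmod \<delta>) * \<rho>"
      proof -
        have "Suc (Suc ?k) mod 3 = 2" "?k mod 3 = 0" by presburger+
        then have cc: "c (Suc (Suc ?k)) = b" "c ?k = 0" by (simp_all add: c_def)
        have "f (?Z (Suc ?k)) - b = (?Z (Suc (Suc ?k)) - c (Suc (Suc ?k))) + \<delta> * (?Z ?k - c ?k)"
          by (simp add: cc)
        then have "cmod (f (?Z (Suc ?k)) - b) \<le> cmod (?Z (Suc (Suc ?k)) - c (Suc (Suc ?k))) + cmod \<delta> * cmod (?Z ?k - c ?k)"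
          by (metis norm_triangle_ineq norm_mult)
        also have "\<dots> \<le> \<rho> + cmod \<delta> * \<rho>"
          using Zc[THEN less_imp_le] by (intro add_mono mult_left_mono norm_ge_zero)
        finally show ?thesis by (simp add: algebra_simps)
      qed
      ultimately show ?thesis
        unfolding 1 K_def using closure_subset by (auto simp: dist_norm norm_minus_commute)
    qed
    ultimately show ?thesis by blast
  qed
  have "\<exists>E. finite E \<and> E \<subseteq> X \<and> separated_set F (3 * j) \<epsilon> E \<and> card E \<ge> M ^ j" for j
  proof -
    let ?S = "PiE {..<j} (\<lambda>_. {..<M})"
    have "\<exists>t. (t, 0) \<in> X \<and> (\<forall>i<j. fst ((F ^^ (3 * i)) (t, 0)) \<in> K (u i))" if "u \<in> ?S" for u
    proof -
      \<comment> \<open>The finite word is continued by the symbol 0, which exists since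
        \<open>M > 0\<close>.\<close>
      have "(if i < j then u i else 0) < M" for i using that \<open>M > 0\<close> by auto
      from itin[of "\<lambda>i. if i < j then u i else 0", OF this] show ?thesis by (metis (full_types))
    qed
    then obtain T where T: "\<And>u. u \<in> ?S \<Longrightarrow> (T u, 0) \<in> X \<and> (\<forall>i<j. fst ((F ^^ (3 * i)) (T u, 0)) \<in> K (u i))"
      by metis
    let ?e = "\<lambda>u. (T u, 0 :: complex)"
    have sep: "\<exists>k<3 * j. dist ((F ^^ k) (?e u)) ((F ^^ k) (?e u')) > \<epsilon>"
      if "u \<in> ?S" "u' \<in> ?S" "u \<noteq> u'" for u u'
    proof -
      have "\<exists>i<j. u i \<noteq> u' i"
      proof (rule ccontr)
        assume "\<not> ?thesis"
        then have "u = u'" by (intro PiE_ext[OF that(1,2)]) auto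
        then show False using that(3) by simp
      qed
      then obtain i where i: "i < j" "u i \<noteq> u' i" by blast
      have ui: "u i < M" "u' i < M" using that(1,2) i(1) by (auto simp: PiE_iff)
      have "\<epsilon> < dist (fst ((F ^^ (3 * i)) (?e u))) (fst ((F ^^ (3 * i)) (?e u')))"
        by (rule \<epsilon>(2)[OF ui i(2)]) (use T[OF that(1)] T[OF that(2)] i(1) in blast)+
      also have "\<dots> \<le> dist ((F ^^ (3 * i)) (?e u)) ((F ^^ (3 * i)) (?e u'))"
        by (rule dist_fst_le)
      finally show ?thesis using i(1) by (intro exI[of _ "3 * i"]) auto
    qed
    have "inj_on ?e ?S"
    proof (rule inj_onI, rule ccontr)
      fix u u' assume "u \<in> ?S" "u' \<in> ?S" "?e u = ?e u'" "u \<noteq> u'"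
      then obtain k where "dist ((F ^^ k) (?e u)) ((F ^^ k) (?e u')) > \<epsilon>" using sep[of u u'] by blast
      then show False using \<open>?e u = ?e u'\<close> \<open>\<epsilon> > 0\<close> by simp
    qed
    then have "card (?e ` ?S) = M ^ j" by (simp add: card_image card_PiE)
    moreover have "separated_set F (3 * j) \<epsilon> (?e ` ?S)"
      unfolding separated_set_def
    proof (intro ballI impI)
      fix x y assume "x \<in> ?e ` ?S" "y \<in> ?e ` ?S" "x \<noteq> y"
      then obtain u u' where u: "u \<in> ?S" "x = ?e u" "u' \<in> ?S" "y = ?e u'" by blast
      then have "u \<noteq> u'" using \<open>x \<noteq> y\<close> by blast
      then show "\<exists>k<3 * j. dist ((F ^^ k) x) ((F ^^ k) y) > \<epsilon>"
        unfolding u(2,4) by (rule sep[OF u(1,3)])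
    qed
    moreover have "?e ` ?S \<subseteq> X" using T by blast
    moreover have "finite (?e ` ?S)" by (intro finite_imageI finite_PiE) auto
    ultimately show ?thesis by (intro exI[of _ "?e ` ?S"] conjI) simp_all
  qed
  then show ?thesis
    unfolding F_def[symmetric] using cX FX contF \<epsilon>(1) \<open>M > 0\<close> by (intro htop_ge[of X]) auto
qed

section \<open>Counting components of preimages of discs\<close>

text \<open>A bounded component \<open>Q\<close> of the complement would lie in the disc and have
  its frontier mapped into \<open>A\<close>. Its image would be open and closed in the connected set
  \<open>- A\<close>, hence all of it, although the image is bounded and \<open>- A\<close> is
  not.\<close>

lemma connected_complement_preimage:
  assumes f: "f holomorphic_on UNIV" "\<not> f constant_on UNIV" and "\<rho> > 0"
    and sph: "\<And>z. z \<in> sphere a \<rho> \<Longrightarrow> C \<le> cmod (f z)"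
    and A: "compact A" "A \<subseteq> ball 0 C" "connected (- A)"
  shows "connected (- (cball a \<rho> \<inter> f -` A))"
proof (rule ccontr)
  let ?X = "cball a \<rho> \<inter> f -` A"
  assume "\<not> connected (- ?X)"
  have contf: "continuous_on S f" for S
    using f(1) by (meson holomorphic_on_imp_continuous_on holomorphic_on_subset subset_UNIV)
  have cX: "compact ?X"
    using A(1) contf by (intro compact_Int_closed closed_vimage) (auto intro: compact_imp_closed)
  then have "bounded (- (- ?X))" by (simp only: double_complement compact_imp_bounded)
  then obtain Q where Q: "Q \<in> components (- ?X)" "bounded Q"
    by (rule cobounded_has_bounded_component[OF _ \<open>\<not> connected (- ?X)\<close>]) simp
  have opX: "open (- ?X)" using cX compact_imp_closed by blast
  have opQ: "open Q" by (rule open_components[OF opX Q(1)])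
  have QX: "Q \<subseteq> - ?X" and neQ: "Q \<noteq> {}"
    using Q(1) in_components_subset in_components_nonempty by blast+
  have frQ: "frontier Q \<subseteq> ?X"
    using frontier_of_components_subset[OF Q(1)] frontier_subset_compact[OF cX]
    unfolding frontier_complement by (rule subset_trans)
  \<comment> \<open>Otherwise \<open>Q\<close> would contain the connected unbounded exterior of the
    disc.\<close>
  have QB: "Q \<subseteq> cball a \<rho>"
  proof (rule ccontr)
    assume "\<not> Q \<subseteq> cball a \<rho>"
    then have "Q \<inter> (- cball a \<rho>) \<noteq> {}" by blast
    moreover have "connected (- cball a \<rho>)" "\<not> bounded (- cball a \<rho>)"
      by (auto simp: connected_complement_bounded_convex cobounded_imp_unbounded)
    ultimately have "- cball a \<rho> \<subseteq> Q"
      using components_maximal[OF Q(1)] by blast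
    then show False using \<open>\<not> bounded (- cball a \<rho>)\<close> Q(2) bounded_subset by blast
  qed
  have "open (f ` Q)"
    by (rule open_mapping_thm[OF f(1) _ _ opQ _ f(2)]) auto
  have fQA: "f ` Q \<inter> A = {}" using QX QB by blast
  have "closed (f ` closure Q)"
    using Q(2) contf by (intro compact_imp_closed compact_continuous_image) auto
  moreover have "f ` Q = - A \<inter> f ` closure Q"
    using frQ fQA closure_Un_frontier[of Q] by auto
  ultimately have "closedin (top_of_set (- A)) (f ` Q)"
    by (metis closedin_closed_Int)
  moreover have "openin (top_of_set (- A)) (f ` Q)"
    using \<open>open (f ` Q)\<close> fQA by (intro open_subset) auto
  ultimately have "f ` Q = - A"
    using A(3) neQ connected_clopen by blast
  moreover have "bounded (f ` Q)"
  proof (rule bounded_subset)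
    show "bounded (f ` closure Q)"
      using Q(2) contf by (intro compact_imp_bounded compact_continuous_image) auto
  qed (simp add: closure_subset image_mono)
  ultimately show False
    using A(1) by (metis cobounded_imp_unbounded compact_imp_bounded)
qed

section \<open>Coverings, lifts of segments and logarithms\<close>

text \<open>Since the modulus is at least \<open>C\<close> on the sphere, \<open>f\<close>
  restricted to the disc is proper over \<open>ball 0 C\<close>; the absence of critical points over
  \<open>\<sigma>\<close> then makes it a local product there.\<close>

lemma covering_space_entire:
  assumes f: "f holomorphic_on UNIV" "\<not> f constant_on UNIV" and "\<rho> > 0"
    and sph: "\<And>z. z \<in> sphere a \<rho> \<Longrightarrow> C \<le> cmod (f z)"
    and z0: "z0 \<in> ball a \<rho>" "cmod (f z0) < C"
    and \<sigma>: "\<sigma> \<subseteq> ball 0 C" and reg: "\<And>z. \<lbrakk>z \<in> ball a \<rho>; f z \<in> \<sigma>\<rbrakk> \<Longrightarrow> deriv f z \<noteq> 0"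
  shows "covering_space (ball a \<rho> \<inter> f -` \<sigma>) f \<sigma>"
proof
  let ?K = "ball a \<rho> \<inter> f -` \<sigma>"
  have contf: "continuous_on S f" and holf: "f holomorphic_on S" for S
    using f(1) by (meson holomorphic_on_imp_continuous_on holomorphic_on_subset subset_UNIV)+
  show "continuous_on ?K f" by (rule contf)
  have "ball 0 C \<subseteq> f ` ball a \<rho>"
  proof (rule ball_subset_holomorphic_image[OF _ _ holf contf z0(1)])
    show "f x \<notin> ball 0 C" if "x \<in> frontier (ball a \<rho>)" for x
      using that \<open>\<rho> > 0\<close> sph[of x] by (simp add: frontier_ball)
  qed (use z0 in auto)
  then show "f ` ?K = \<sigma>" using \<sigma> by blast
  fix x assume x: "x \<in> \<sigma>"
  define Y where "Y = {y \<in> ball a \<rho>. f y = x}"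
  \<comment> \<open>No preimage of \<open>x\<close> lies on the sphere, so the fibre is the zero set
    of a non-constant function in a compact disc and hence finite.\<close>
  have Y: "Y = {y \<in> cball a \<rho>. f y - x = 0}"
    using sph x \<sigma> by (force simp: Y_def order_le_less)
  have "finite {y \<in> cball a \<rho>. f y - x = 0}"
  proof (rule holomorphic_compact_finite_zeros[of "\<lambda>y. f y - x" UNIV])
    show "\<not> (\<lambda>y. f y - x) constant_on UNIV"
      using f(2) unfolding constant_on_def by (metis diff_add_cancel)
  qed (auto intro!: holomorphic_intros holf)
  then have finY: "finite Y" using Y by simp
  have "eventually (\<lambda>r. \<forall>y\<in>Y. ball y r \<subseteq> ball a \<rho> \<and> inj_on f (ball y r) \<and>
          (\<forall>y'\<in>Y. y' \<noteq> y \<longrightarrow> ball y r \<inter> ball y' r = {})) (at_right (0::real))"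
  proof (rule eventually_ball_finite[OF finY], rule ballI)
    fix y assume y: "y \<in> Y"
    obtain r1 where r1: "r1 > 0" "ball y r1 \<subseteq> ball a \<rho>"
      using y unfolding Y_def by (metis (no_types, lifting) mem_Collect_eq open_ball open_contains_ball)
    then have "eventually (\<lambda>r. ball y r \<subseteq> ball a \<rho>) (at_right 0)"
      unfolding eventually_at_right_field using r1 by (intro exI[of _ r1]) (meson less_imp_le order_trans subset_ball)
    moreover have "deriv f y \<noteq> 0" using y x reg by (auto simp: Y_def)
    then obtain r2 where r2: "r2 > 0" "inj_on f (ball y r2)"
      using has_complex_derivative_locally_injective[OF f(1), of y] by auto
    moreover have "eventually (\<lambda>r. inj_on f (ball y r)) (at_right 0)"
      unfolding eventually_at_right_field using r2
      by (intro exI[of _ r2]) (meson less_imp_le inj_on_subset subset_ball)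
    moreover have "eventually (\<lambda>r. \<forall>y'\<in>Y. y' \<noteq> y \<longrightarrow> ball y r \<inter> ball y' r = {}) (at_right 0)"
    proof (rule eventually_ball_finite[OF finY], rule ballI)
      fix y' assume "y' \<in> Y"
      show "eventually (\<lambda>r. y' \<noteq> y \<longrightarrow> ball y r \<inter> ball y' r = {}) (at_right 0)"
      proof (cases "y' = y")
        case False
        have "ball y r \<inter> ball y' r = {}" if "r < dist y y' / 2" for r
          using that by (intro disjoint_ballI) linarith
        then show ?thesis
          unfolding eventually_at_right_field using False
          by (intro exI[of _ "dist y y' / 2"]) auto
      qed simp
    qed
    ultimately show "eventually (\<lambda>r. ball y r \<subseteq> ball a \<rho> \<and> inj_on f (ball y r) \<and>
          (\<forall>y'\<in>Y. y' \<noteq> y \<longrightarrow> ball y r \<inter> ball y' r = {})) (at_right 0)"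
      by (simp add: eventually_conj_iff)
  qed
  then obtain r0 where r0: "r0 > (0::real)" "\<And>r. \<lbrakk>0 < r; r < r0\<rbrakk> \<Longrightarrow> \<forall>y\<in>Y. ball y r \<subseteq> ball a \<rho> \<and> inj_on f (ball y r) \<and>
          (\<forall>y'\<in>Y. y' \<noteq> y \<longrightarrow> ball y r \<inter> ball y' r = {})"
    unfolding eventually_at_right_field by blast
  define r where "r = r0 / 2"
  have r: "r > 0" "\<And>y. y \<in> Y \<Longrightarrow> ball y r \<subseteq> ball a \<rho>" "\<And>y. y \<in> Y \<Longrightarrow> inj_on f (ball y r)"
    "\<And>y y'. \<lbrakk>y \<in> Y; y' \<in> Y; y' \<noteq> y\<rbrakk> \<Longrightarrow> ball y r \<inter> ball y' r = {}"
    using r0(2)[of r] r0(1) unfolding r_def by auto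
  \<comment> \<open>Removing the image of \<open>D\<close> from the target neighbourhood leaves only
    preimages in the small discs about the fibre, on which \<open>f\<close> is injective.\<close>
  define D where "D = cball a \<rho> - (\<Union>y\<in>Y. ball y r)"
  define T' where "T' = (\<Inter>y\<in>Y. f ` ball y r) - f ` D"
  have opf: "open (f ` ball y r)" if "y \<in> Y" for y
    using r(3)[OF that] by (intro open_mapping_thm3[OF holf]) auto
  have "compact D" unfolding D_def by (intro compact_diff) auto
  then have "closed (f ` D)" by (intro compact_imp_closed compact_continuous_image contf)
  then have opT': "open T'" unfolding T'_def using opf finY by (intro open_Diff open_INT) auto
  have "x \<notin> f ` D"
    using r(1) unfolding D_def using Y by auto
  moreover have "x \<in> f ` ball y r" if "y \<in> Y" for y
    using that r(1) by (auto simp: Y_def intro!: image_eqI[of _ _ y])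
  ultimately have xT': "x \<in> T'" unfolding T'_def by blast
  define T where "T = \<sigma> \<inter> T'"
  define V where "V = (\<lambda>y. ball y r \<inter> f -` T) ` Y"
  have "\<Union>V = ?K \<inter> f -` T"
  proof
    show "\<Union>V \<subseteq> ?K \<inter> f -` T" using r(2) by (auto simp: V_def T_def simp del: mem_ball)
    show "?K \<inter> f -` T \<subseteq> \<Union>V"
    proof
      fix z assume z: "z \<in> ?K \<inter> f -` T"
      then have "f z \<notin> f ` D" by (auto simp: T_def T'_def)
      then have "z \<notin> D" by blast
      then obtain y where "y \<in> Y" "z \<in> ball y r" using z by (auto simp: D_def)
      then show "z \<in> \<Union>V" using z by (auto simp: V_def)
    qed
  qed
  moreover have "openin (top_of_set ?K) u" if u: "u \<in> V" for u
  proof -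
    obtain y where y: "y \<in> Y" "u = ball y r \<inter> f -` T" using u by (auto simp: V_def)
    have "u = ?K \<inter> (ball y r \<inter> f -` T')"
      using y r(2)[OF y(1)] by (auto simp: T_def simp del: mem_ball)
    moreover have "open (ball y r \<inter> f -` T')" using opT' contf by (intro open_Int open_vimage) auto
    ultimately show ?thesis by (metis openin_open_Int)
  qed
  moreover have "pairwise disjnt V"
    unfolding pairwise_def V_def disjnt_def using r(4) by blast
  moreover have "\<exists>q. homeomorphism u T f q" if u: "u \<in> V" for u
  proof -
    obtain y where y: "y \<in> Y" "u = ball y r \<inter> f -` T" using u by (auto simp: V_def)
    have "\<exists>q. homeomorphism (ball y r) (f ` ball y r) f q"
    proof (rule homeomorphism_injective_open_map[OF contf refl r(3)[OF y(1)]])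
      fix W assume "openin (top_of_set (ball y r)) W"
      then have W: "open W" "W \<subseteq> ball y r" by (auto simp: openin_open_eq)
      then have "open (f ` W)"
        using r(3)[OF y(1)] by (intro open_mapping_thm3[OF holf]) (auto intro: inj_on_subset)
      then show "openin (top_of_set (f ` ball y r)) (f ` W)"
        using W by (intro open_subset) auto
    qed blast
    then obtain q where q: "homeomorphism (ball y r) (f ` ball y r) f q" by blast
    have fu: "f ` u = T"
    proof
      show "T \<subseteq> f ` u"
      proof
        fix w assume w: "w \<in> T"
        then have "w \<in> f ` ball y r" using y(1) unfolding T_def T'_def by blast
        then show "w \<in> f ` u" using w unfolding y(2) by blast
      qed
    qed (use y(2) in blast)
    have "u \<subseteq> ball y r" unfolding y(2) by blast
    moreover have "T \<subseteq> f ` ball y r" unfolding T_def T'_def using y(1) by blast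
    ultimately have "homeomorphism u T f q"
      by (rule homeomorphism_of_subsets[OF q _ _ fu])
    then show ?thesis by blast
  qed
  moreover have "openin (top_of_set \<sigma>) T" unfolding T_def using opT' by (rule openin_open_Int)
  moreover have "x \<in> T" using x xT' by (simp add: T_def)
  ultimately show "\<exists>T. x \<in> T \<and> openin (top_of_set \<sigma>) T \<and>
      (\<exists>v. \<Union>v = ?K \<inter> f -` T \<and> (\<forall>u\<in>v. openin (top_of_set ?K) u) \<and> pairwise disjnt v \<and>
        (\<forall>u\<in>v. \<exists>q. homeomorphism u T f q))"
    by (intro exI[of _ T] conjI exI[of _ V] ballI)
qed

text \<open>The values are integer multiples of \<open>2 * pi * \<i>\<close>, a discrete set. Two
  continuous logarithms of the same function thus differ by a constant on a connected set.\<close>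

lemma exp_eq_1_imp_constant:
  assumes "connected S" "continuous_on S u" "\<And>x. x \<in> S \<Longrightarrow> exp (u x) = (1::complex)"
    and "x \<in> S" "y \<in> S"
  shows "u x = u y"
proof -
  have "u constant_on S"
  proof (rule continuous_discrete_range_constant[OF assms(1,2)])
    fix x assume x: "x \<in> S"
    have "1 \<le> norm (u y - u x)" if "y \<in> S" "u y \<noteq> u x" for y
    proof -
      have "exp (u y - u x) = 1" using assms(3) x that by (simp add: exp_diff)
      then obtain n :: int where n: "Re (u y - u x) = 0" "Im (u y - u x) = of_int (2 * n) * pi"
        unfolding exp_eq_1 by blast
      have "n \<noteq> 0" using n that by (auto simp: complex_eq_iff)
      then have "1 \<le> \<bar>of_int (2 * n) :: real\<bar>" by simp
      then have "1 * 1 \<le> \<bar>of_int (2 * n)\<bar> * pi" using pi_ge_two by (intro mult_mono) linarith+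
      also have "\<dots> = \<bar>Im (u y - u x)\<bar>" using n by (simp add: abs_mult)
      finally show ?thesis using abs_Im_le_cmod[of "u y - u x"] by linarith
    qed
    then show "\<exists>e>0. \<forall>y. y \<in> S \<and> u y \<noteq> u x \<longrightarrow> e \<le> norm (u y - u x)"
      by (intro exI[of _ 1]) auto
  qed
  then show ?thesis using assms(4,5) by (metis constant_on_def)
qed

text \<open>Allows the base value to be moved off the critical values without losing points of the
  fibre. Discs of radius \<open>e / 2\<close> about the points of \<open>S\<close> are disjoint, and
  their open images share a neighbourhood of \<open>c\<close>.\<close>

lemma finite_fibre_nearby:
  assumes f: "f holomorphic_on UNIV" "\<not> f constant_on UNIV"
    and S: "finite S" "S \<subseteq> ball a \<rho>" "\<And>s. s \<in> S \<Longrightarrow> f s = c"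
  shows "\<exists>\<eta>>0. \<forall>p\<in>ball c \<eta>. \<exists>S'\<subseteq>ball a \<rho> \<inter> f -` {p}. finite S' \<and> card S' = card S"
proof -
  have holf: "f holomorphic_on A" for A
    using f(1) holomorphic_on_subset by blast
  obtain e where e: "e > 0" "\<And>s s'. \<lbrakk>s \<in> S; s' \<in> S; s \<noteq> s'\<rbrakk> \<Longrightarrow> e \<le> dist s s'"
  proof (cases "\<exists>s\<in>S. \<exists>s'\<in>S. s \<noteq> s'")
    case True
    let ?D = "(\<lambda>(s, s'). dist s s') ` {(s, s'). s \<in> S \<and> s' \<in> S \<and> s \<noteq> s'}"
    have "finite {(s, s'). s \<in> S \<and> s' \<in> S \<and> s \<noteq> s'}"
      by (rule finite_subset[of _ "S \<times> S"]) (use S(1) in auto)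
    then have D: "finite ?D" "?D \<noteq> {}" using True by auto
    have "Min ?D > 0" using D by (subst Min_gr_iff) auto
    moreover have "Min ?D \<le> dist s s'" if "s \<in> S" "s' \<in> S" "s \<noteq> s'" for s s'
      using that by (intro Min_le[OF D(1)]) force
    ultimately show ?thesis using that by blast
  next
    case False
    then show ?thesis using that[of 1] by auto
  qed
  have op: "open (f ` (ball s (e / 2) \<inter> ball a \<rho>))" for s
    by (rule open_mapping_thm[OF f(1) _ _ _ _ f(2)]) auto
  define O' where "O' = (\<Inter>s\<in>S. f ` (ball s (e / 2) \<inter> ball a \<rho>))"
  have "open O'" unfolding O'_def using S(1) op by (intro open_INT) auto
  moreover have "c \<in> O'"
    unfolding O'_def
  proof
    fix s assume "s \<in> S"
    then show "c \<in> f ` (ball s (e / 2) \<inter> ball a \<rho>)"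
      using S(2,3) e(1) by (intro image_eqI[of _ _ s]) auto
  qed
  ultimately obtain \<eta> where \<eta>: "\<eta> > 0" "ball c \<eta> \<subseteq> O'"
    by (meson openE)
  have "\<exists>S'\<subseteq>ball a \<rho> \<inter> f -` {p}. finite S' \<and> card S' = card S" if p: "p \<in> ball c \<eta>" for p
  proof -
    have "\<forall>s\<in>S. \<exists>z. z \<in> ball s (e / 2) \<inter> ball a \<rho> \<and> f z = p"
      using p \<eta>(2) unfolding O'_def by (metis (no_types, lifting) INT_E imageE subsetD)
    then obtain h where h: "\<And>s. s \<in> S \<Longrightarrow> h s \<in> ball s (e / 2) \<inter> ball a \<rho> \<and> f (h s) = p"
      by metis
    have "inj_on h S"
    proof (rule inj_onI, rule ccontr)
      fix s s' assume ss: "s \<in> S" "s' \<in> S" "h s = h s'" "s \<noteq> s'"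
      have "dist s (h s) < e / 2" "dist s' (h s) < e / 2"
        using h[OF ss(1)] h[OF ss(2)] ss(3) by auto
      then have "dist s s' < e" by (metis dist_commute dist_triangle_half_l)
      then show False using e(2)[OF ss(1,2,4)] by simp
    qed
    then show ?thesis using h S(1)
      by (intro exI[of _ "h ` S"]) (auto simp: card_image simp del: mem_ball)
  qed
  then show ?thesis using \<eta>(1) by blast
qed

text \<open>The point \<open>p\<close> runs through a line that misses \<open>q\<close>, so each element of \<open>B\<close> excludes at most one choice.\<close>
lemma segment_avoiding_finite:
  fixes c q :: complex
  assumes "finite B" "q \<notin> B" "q \<noteq> c" "\<eta> > 0"
  obtains p where "p \<in> ball c \<eta>" "closed_segment p q \<inter> B = {}"
proof -
  let ?p = "\<lambda>t::real. c + \<i> * of_real t * (q - c)"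
  define T where "T = {0<..<\<eta> / cmod (q - c)}"
  have "infinite T"
    unfolding T_def using assms by (intro infinite_Ioo) simp
  have "\<exists>t\<in>T. closed_segment (?p t) q \<inter> B = {}"
  proof (rule ccontr)
    assume "\<not> ?thesis"
    then have "\<forall>t\<in>T. \<exists>b. b \<in> B \<and> b \<in> closed_segment (?p t) q" by blast
    then obtain h where h: "\<And>t. t \<in> T \<Longrightarrow> h t \<in> B \<and> h t \<in> closed_segment (?p t) q" by metis
    have "inj_on h T"
    proof (rule inj_onI)
      fix s t assume st: "s \<in> T" "t \<in> T" "h s = h t"
      \<comment> \<open>Up to real multiples and the common factor \<open>c - q\<close>, the segment
        leaves \<open>q\<close> in the direction \<open>1 - \<i> * of_real t\<close>; comparing real
        and imaginary parts recovers \<open>t\<close>.\<close>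
      have "\<exists>u. h t - q = of_real u * ((c - q) * (1 - \<i> * of_real t))" if "t \<in> T" for t
      proof -
        have "h t \<in> closed_segment (?p t) q" using h that by blast
        then obtain u where "h t = (1 - u) *\<^sub>R ?p t + u *\<^sub>R q" unfolding in_segment by blast
        then have "h t - q = of_real (1 - u) * ((c - q) * (1 - \<i> * of_real t))"
          by (simp add: scaleR_conv_of_real algebra_simps)
        then show ?thesis by blast
      qed
      then obtain u v where uv: "h s - q = of_real u * ((c - q) * (1 - \<i> * of_real s))"
        "h t - q = of_real v * ((c - q) * (1 - \<i> * of_real t))" using st(1,2) by meson
      have "(c - q) * (of_real u * (1 - \<i> * of_real s)) = (c - q) * (of_real v * (1 - \<i> * of_real t))"
        using uv st(3) by (simp add: algebra_simps)
      then have eq: "of_real u * (1 - \<i> * of_real s) = of_real v * (1 - \<i> * of_real t)"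
        using assms(3) by simp
      have "u = v" using arg_cong[OF eq, of Re] by simp
      moreover have "u * s = v * t" using arg_cong[OF eq, of Im] by simp
      moreover have "u \<noteq> 0" using uv(1) h[OF st(1)] assms(2) by auto
      ultimately show "s = t" by simp
    qed
    moreover have "h ` T \<subseteq> B" using h by blast
    ultimately show False using \<open>infinite T\<close> assms(1) by (meson finite_subset inj_on_finite)
  qed
  then obtain t where t: "t \<in> T" "closed_segment (?p t) q \<inter> B = {}" by blast
  have "?p t - c = \<i> * of_real t * (q - c)" by simp
  then have "cmod (?p t - c) = \<bar>t\<bar> * cmod (q - c)" by (simp only: norm_mult norm_ii norm_of_real mult_1)
  also have "\<dots> < \<eta>" using t(1) assms(3) by (simp add: T_def pos_less_divide_eq)
  finally have "cmod (?p t - c) < \<eta>" .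
  then have "?p t \<in> ball c \<eta>" by (simp add: dist_norm norm_minus_commute)
  then show ?thesis using t(2) that by blast
qed

lemma finite_critical_points:
  assumes f: "f holomorphic_on UNIV" "\<not> f constant_on UNIV"
  shows "finite {z \<in> cball a \<rho>. deriv f z = 0}"
proof (cases "deriv f constant_on UNIV")
  case True
  then obtain d where d: "\<And>z. deriv f z = d" by (auto simp: constant_on_def)
  have "d \<noteq> 0"
  proof
    assume "d = 0"
    have "(f has_field_derivative 0) (at z)" for z
      using holomorphic_derivI[OF f(1), of z] d \<open>d = 0\<close> by simp
    then have "\<exists>c. \<forall>z\<in>UNIV. f z = c"
      by (intro has_field_derivative_zero_constant) auto
    then show False using f(2) unfolding constant_on_def by auto
  qed
  then show ?thesis using d by simp
next
  case False
  show ?thesis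
    by (rule holomorphic_compact_finite_zeros[of "deriv f" UNIV])
      (use False f(1) holomorphic_deriv in auto)
qed

text \<open>Convex sets are Borsukian, and gluing closed sets along a connected intersection
  preserves this: first a disc with the segment, then the other disc. For compact plane sets the
  property amounts to a connected complement.\<close>

lemma Borsukian_two_discs_segment:
  fixes p q :: complex
  assumes "cball p v \<inter> cball q v = {}" "p0 \<in> cball p v" "p1 \<in> cball q v"
  shows "Borsukian (cball p v \<union> closed_segment p0 p1 \<union> cball q v)"
proof -
  let ?\<sigma> = "closed_segment p0 p1"
  have cl: "closed (cball p v)" "closed (cball q v)" "closed ?\<sigma>" by auto
  have 1: "Borsukian (cball p v \<union> ?\<sigma>)"
  proof (rule Borsukian_closed_Un)
    show "connected (cball p v \<inter> ?\<sigma>)"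
      by (intro convex_connected convex_Int) auto
  qed (use cl in \<open>auto intro: closed_subset convex_imp_Borsukian\<close>)
  show ?thesis
  proof (rule Borsukian_closed_Un[OF _ _ 1])
    have "(cball p v \<union> ?\<sigma>) \<inter> cball q v = ?\<sigma> \<inter> cball q v"
      using assms(1) by blast
    then show "connected ((cball p v \<union> ?\<sigma>) \<inter> cball q v)"
      by (simp only:) (intro convex_connected convex_Int convex_closed_segment convex_cball)
  qed (use cl in \<open>auto intro!: closed_subset closed_Un convex_imp_Borsukian\<close>)
qed

text \<open>The family \<open>G\<close> lists the lifts of the segment by their starting points over
  \<open>p\<close>. They exist because the segment is simply connected; uniqueness of lifts makes
  them disjoint and makes them exhaust the preimage.\<close>

lemma segment_lift:
  assumes f: "f holomorphic_on UNIV" "\<not> f constant_on UNIV" and "\<rho> > 0"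
    and sph: "\<And>z. z \<in> sphere a \<rho> \<Longrightarrow> C \<le> cmod (f z)"
    and \<sigma>: "closed_segment p q \<subseteq> ball 0 C"
    and reg: "\<And>z. \<lbrakk>z \<in> ball a \<rho>; f z \<in> closed_segment p q\<rbrakk> \<Longrightarrow> deriv f z \<noteq> 0"
  obtains G where "\<And>z. z \<in> ball a \<rho> \<inter> f -` {p} \<Longrightarrow> continuous_on (closed_segment p q) (G z)"
    "\<And>z. z \<in> ball a \<rho> \<inter> f -` {p} \<Longrightarrow> G z p = z"
    "\<And>z w. \<lbrakk>z \<in> ball a \<rho> \<inter> f -` {p}; w \<in> closed_segment p q\<rbrakk> \<Longrightarrow> G z w \<in> ball a \<rho>"
    "\<And>z w. \<lbrakk>z \<in> ball a \<rho> \<inter> f -` {p}; w \<in> closed_segment p q\<rbrakk> \<Longrightarrow> f (G z w) = w"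
    "\<And>z. \<lbrakk>z \<in> ball a \<rho>; f z \<in> closed_segment p q\<rbrakk> \<Longrightarrow> \<exists>y\<in>ball a \<rho> \<inter> f -` {p}. G y (f z) = z"
    "\<And>y z w. \<lbrakk>y \<in> ball a \<rho> \<inter> f -` {p}; z \<in> ball a \<rho> \<inter> f -` {p}; w \<in> closed_segment p q; G y w = G z w\<rbrakk> \<Longrightarrow> y = z"
proof (cases "\<exists>z\<in>ball a \<rho>. cmod (f z) < C")
  \<comment> \<open>Nothing in the disc lies over the segment, so every clause is vacuous and any
    \<open>G\<close> will do.\<close>
  case False
  then have no: "\<not> (z \<in> ball a \<rho> \<and> f z \<in> closed_segment p q)" for z
    using \<sigma> by (auto simp: subset_iff)
  have no': "z \<notin> ball a \<rho> \<inter> f -` {p}" for z using no[of z] by auto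
  show ?thesis by (rule that[of "\<lambda>_ _. 0"]) (use no no' in blast)+
next
  case True
  let ?\<sigma> = "closed_segment p q"
  let ?K = "ball a \<rho> \<inter> f -` ?\<sigma>"
  obtain z0 where z0: "z0 \<in> ball a \<rho>" "cmod (f z0) < C" using True by blast
  have cov: "covering_space ?K f ?\<sigma>"
    by (rule covering_space_entire[OF f \<open>\<rho> > 0\<close> sph z0 \<sigma> reg])
  have lift: "\<exists>g. continuous_on ?\<sigma> g \<and> g \<in> ?\<sigma> \<rightarrow> ?K \<and> g w = z \<and> (\<forall>y\<in>?\<sigma>. f (g y) = y)"
    if z: "z \<in> ?K" "f z = w" for z w
  proof -
    obtain g where "continuous_on ?\<sigma> g" "g \<in> ?\<sigma> \<rightarrow> ?K" "g w = z" "\<And>y. y \<in> ?\<sigma> \<Longrightarrow> f (g y) = y"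
    proof (rule covering_space_lift_strong[OF cov z(1), of w ?\<sigma> "\<lambda>y. y"])
      show "simply_connected ?\<sigma>" "locally path_connected ?\<sigma>"
        by (auto intro: convex_imp_simply_connected convex_imp_locally_path_connected)
    qed (use z in auto)
    then show ?thesis by blast
  qed
  have uniq: "g x = h x"
    if "continuous_on ?\<sigma> g" "g \<in> ?\<sigma> \<rightarrow> ?K" "\<forall>y\<in>?\<sigma>. f (g y) = y"
      "continuous_on ?\<sigma> h" "h \<in> ?\<sigma> \<rightarrow> ?K" "\<forall>y\<in>?\<sigma>. f (h y) = y" "w \<in> ?\<sigma>" "g w = h w" "x \<in> ?\<sigma>"
    for g h w x
    by (rule covering_space_lift_unique[OF cov, where a = w and ?g1.0 = g and ?g2.0 = h and T = ?\<sigma> and f = "\<lambda>y. y"])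
      (use that in auto)
  have "\<forall>z\<in>ball a \<rho> \<inter> f -` {p}. \<exists>g. continuous_on ?\<sigma> g \<and> g \<in> ?\<sigma> \<rightarrow> ?K \<and> g p = z \<and> (\<forall>y\<in>?\<sigma>. f (g y) = y)"
    by (intro ballI lift) auto
  then obtain G where G: "\<And>z. z \<in> ball a \<rho> \<inter> f -` {p} \<Longrightarrow>
      continuous_on ?\<sigma> (G z) \<and> G z \<in> ?\<sigma> \<rightarrow> ?K \<and> G z p = z \<and> (\<forall>y\<in>?\<sigma>. f (G z y) = y)"
    by metis
  show ?thesis
  proof (rule that[of G])
    fix z assume z: "z \<in> ball a \<rho>" "f z \<in> ?\<sigma>"
    then obtain g where g: "continuous_on ?\<sigma> g" "g \<in> ?\<sigma> \<rightarrow> ?K" "g (f z) = z" "\<forall>y\<in>?\<sigma>. f (g y) = y"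
      using lift[of z "f z"] by auto
    \<comment> \<open>The lift through \<open>z\<close> is followed back to its value over
      \<open>p\<close>, which names the index; uniqueness identifies it with the corresponding
      \<open>G\<close>.\<close>
    have "g p \<in> ?K" using g(2) by (rule funcset_mem) simp
    moreover have "f (g p) = p" using g(4) by simp
    ultimately have y: "g p \<in> ball a \<rho> \<inter> f -` {p}" by simp
    note Gy = G[OF y]
    have "G (g p) (f z) = g (f z)"
      by (rule uniq[of "G (g p)" g p "f z"]) (use Gy g z in auto)
    then show "\<exists>y\<in>ball a \<rho> \<inter> f -` {p}. G y (f z) = z" using y g(3) by auto
  next
    fix y z w assume yz: "y \<in> ball a \<rho> \<inter> f -` {p}" "z \<in> ball a \<rho> \<inter> f -` {p}" "w \<in> ?\<sigma>" "G y w = G z w"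
    have "G y p = G z p"
      by (rule uniq[of "G y" "G z" w p]) (use G[OF yz(1)] G[OF yz(2)] yz in auto)
    then show "y = z" using G[OF yz(1)] G[OF yz(2)] by simp
  next
    fix z w assume z: "z \<in> ball a \<rho> \<inter> f -` {p}" "w \<in> ?\<sigma>"
    then show "G z w \<in> ball a \<rho>" "f (G z w) = w" using G[OF z(1)] by (auto simp: Pi_iff)
  qed (use G in blast)+
qed

section \<open>Components over two discs\<close>

text \<open>Each lift is sent to the pair of components containing its two ends. This is injective
  because the preimage of the dumbbell does not separate the plane, so that continuous functions
  without zeros on it have continuous logarithms. \<open>A\<close> and \<open>B\<close> collect the
  components that occur as ends.\<close>

lemma card_fibre_le_components:
  assumes f: "f holomorphic_on UNIV" "\<not> f constant_on UNIV" and "\<rho> > 0"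
    and sph: "\<And>z. z \<in> sphere a \<rho> \<Longrightarrow> C \<le> cmod (f z)"
    and disc: "cball p v \<subseteq> ball 0 C" "cball q v \<subseteq> ball 0 C" "cball p v \<inter> cball q v = {}"
    and S: "finite S" "S \<subseteq> ball a \<rho>" "\<And>s. s \<in> S \<Longrightarrow> f s = c" and c: "c \<in> ball p v"
  obtains A B where "finite A" "A \<subseteq> components (ball a \<rho> \<inter> f -` ball p v)"
    "finite B" "B \<subseteq> components (ball a \<rho> \<inter> f -` ball q v)" "card S \<le> card A * card B"
proof -
  have contf: "continuous_on A f" for A
    using f(1) by (meson holomorphic_on_imp_continuous_on holomorphic_on_subset subset_UNIV)
  define crit where "crit = f ` {z \<in> cball a \<rho>. deriv f z = 0}"
  have fin: "finite crit" unfolding crit_def using finite_critical_points[OF f] by simp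
  have "v > 0" using c by (metis ball_eq_empty emptyE not_le)
  then have "infinite (ball q v)"
    by (metis centre_in_ball finite_imp_not_open open_ball empty_iff)
  then have "infinite (ball q v - crit)" using fin by simp
  then obtain p1 where p1: "p1 \<in> ball q v" "p1 \<notin> crit" by (metis Diff_iff ex_in_conv finite.emptyI)
  have "p1 \<noteq> c" using p1 c disc(3) ball_subset_cball by blast
  \<comment> \<open>The value \<open>c\<close> may be critical; a nearby \<open>p0\<close> with at
    least as many preimages as \<open>S\<close> has points allows a segment to \<open>p1\<close>
    free of critical values.\<close>
  obtain \<eta> where \<eta>: "\<eta> > 0" "\<And>x. x \<in> ball c \<eta> \<Longrightarrow> \<exists>S'\<subseteq>ball a \<rho> \<inter> f -` {x}. finite S' \<and> card S' = card S"
    using finite_fibre_nearby[OF f S] by blast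
  obtain \<eta>' where \<eta>': "\<eta>' > 0" "ball c \<eta>' \<subseteq> ball p v"
    using c by (meson openE open_ball)
  obtain p0 where p0: "p0 \<in> ball c (min \<eta> \<eta>')" "closed_segment p0 p1 \<inter> crit = {}"
    using segment_avoiding_finite[OF fin p1(2) \<open>p1 \<noteq> c\<close>, of "min \<eta> \<eta>'"] \<eta> \<eta>' by (metis min_less_iff_conj)
  have p0v: "p0 \<in> ball p v" using p0(1) \<eta>' by auto
  obtain S' where S': "S' \<subseteq> ball a \<rho> \<inter> f -` {p0}" "finite S'" "card S' = card S"
    using \<eta>(2)[of p0] p0(1) by auto
  let ?\<sigma> = "closed_segment p0 p1"
  let ?Y = "ball a \<rho> \<inter> f -` {p0}"
  have p01: "p0 \<in> cball p v" "p1 \<in> cball q v" using p0v p1 by auto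
  have \<sigma>C: "?\<sigma> \<subseteq> ball 0 C"
    using p01 disc by (intro closed_segment_subset) auto
  have reg: "deriv f z \<noteq> 0" if "z \<in> ball a \<rho>" "f z \<in> ?\<sigma>" for z
    using that p0(2) unfolding crit_def by (auto simp: disjoint_iff)
  obtain G where G: "\<And>z. z \<in> ?Y \<Longrightarrow> continuous_on ?\<sigma> (G z)" "\<And>z. z \<in> ?Y \<Longrightarrow> G z p0 = z"
      "\<And>z w. \<lbrakk>z \<in> ?Y; w \<in> ?\<sigma>\<rbrakk> \<Longrightarrow> G z w \<in> ball a \<rho>"
      "\<And>z w. \<lbrakk>z \<in> ?Y; w \<in> ?\<sigma>\<rbrakk> \<Longrightarrow> f (G z w) = w"
      "\<And>z. \<lbrakk>z \<in> ball a \<rho>; f z \<in> ?\<sigma>\<rbrakk> \<Longrightarrow> \<exists>y\<in>?Y. G y (f z) = z"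
      "\<And>y z w. \<lbrakk>y \<in> ?Y; z \<in> ?Y; w \<in> ?\<sigma>; G y w = G z w\<rbrakk> \<Longrightarrow> y = z"
    by (rule segment_lift[OF f \<open>\<rho> > 0\<close> sph \<sigma>C reg]) (assumption | blast)+
  define A where "A = cball p v \<union> ?\<sigma> \<union> cball q v"
  define X where "X = cball a \<rho> \<inter> f -` A"
  have cA: "compact A" unfolding A_def by (intro compact_Un) auto
  have AC: "A \<subseteq> ball 0 C" unfolding A_def using disc \<sigma>C by blast
  have "connected (- A)"
    using Borsukian_two_discs_segment[OF disc(3) p01] Borsukian_separation_compact[OF cA]
    unfolding A_def by blast
  then have "connected (- X)"
    unfolding X_def by (intro connected_complement_preimage[OF f \<open>\<rho> > 0\<close> sph cA AC])
  moreover have cX: "compact X"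
    unfolding X_def using cA contf by (intro compact_Int_closed closed_vimage) (auto intro: compact_imp_closed)
  ultimately have "Borsukian X" by (simp add: Borsukian_separation_compact)
  have Xball: "X \<subseteq> ball a \<rho>"
  proof
    fix z assume z: "z \<in> X"
    then have "cmod (f z) < C" using AC by (auto simp: X_def)
    then show "z \<in> ball a \<rho>" using z sph[of z] by (auto simp: X_def order_le_less)
  qed
  have GX: "G z w \<in> X" if "z \<in> ?Y" "w \<in> ?\<sigma>" for z w
    using G(3,4)[OF that] that(2) by (simp add: X_def A_def)
  have cG: "compact (G z ` ?\<sigma>)" if "z \<in> ?Y" for z
    by (intro compact_continuous_image G(1) that) auto
  have disjG: "G y ` ?\<sigma> \<inter> G z ` ?\<sigma> = {}" if yz: "y \<in> ?Y" "z \<in> ?Y" "y \<noteq> z" for y z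
  proof (rule equals0I)
    fix x assume "x \<in> G y ` ?\<sigma> \<inter> G z ` ?\<sigma>"
    then obtain w w' where w: "w \<in> ?\<sigma>" "x = G y w" "w' \<in> ?\<sigma>" "x = G z w'" by blast
    then have "w = w'" using G(4)[OF yz(1) w(1)] G(4)[OF yz(2) w(3)] by simp
    then show False using G(6)[OF yz(1,2) w(1)] w yz(3) by simp
  qed
  have finY: "finite ?Y"
  proof -
    have "finite {z \<in> cball a \<rho>. f z - p0 = 0}"
    proof (rule holomorphic_compact_finite_zeros[of "\<lambda>z. f z - p0" UNIV])
      show "\<not> (\<lambda>z. f z - p0) constant_on UNIV"
        using f(2) unfolding constant_on_def by (metis diff_add_cancel)
    qed (auto intro!: holomorphic_intros f(1))
    then show ?thesis by (rule rev_finite_subset) auto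
  qed
  \<comment> \<open>A phase going from 0 on one disc to 1 on the other, so that
    \<open>exp (2 * of_real pi * \<i> * of_real (\<tau> w))\<close> is 1 on both.\<close>
  obtain \<tau> :: "complex \<Rightarrow> real" where \<tau>: "continuous_on UNIV \<tau>" "\<And>x. x \<in> cball p v \<Longrightarrow> \<tau> x = 0"
    "\<And>x. x \<in> cball q v \<Longrightarrow> \<tau> x = 1"
    using Urysohn[OF closed_cball closed_cball disc(3), of 0 "1::real"] by metis
  let ?I = "\<lambda>z. connected_component_set (ball a \<rho> \<inter> f -` ball p v) z"
  let ?J = "\<lambda>z. connected_component_set (ball a \<rho> \<inter> f -` ball q v) (G z p1)"
  have end0: "z \<in> ball a \<rho> \<inter> f -` ball p v" if "z \<in> ?Y" for z
    using that p0v by auto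
  have end1: "G z p1 \<in> ball a \<rho> \<inter> f -` ball q v" if "z \<in> ?Y" for z
    using G(3,4)[OF that, of p1] p1 by simp
  have inj: "inj_on (\<lambda>z. (?I z, ?J z)) ?Y"
  proof (rule inj_onI, rule ccontr)
    fix z z' assume z: "z \<in> ?Y" "z' \<in> ?Y" "(?I z, ?J z) = (?I z', ?J z')" and "z \<noteq> z'"
    define \<alpha> where "\<alpha> = G z ` ?\<sigma>"
    \<comment> \<open>A closed set containing the part of \<open>X\<close> off the lift
      \<open>\<alpha>\<close>. It meets \<open>\<alpha>\<close> only over the two discs, where the
      phase is an integer and the two cases of \<open>\<theta>\<close> agree.\<close>
    define R where "R = (cball a \<rho> \<inter> f -` (cball p v \<union> cball q v)) \<union> (\<Union>y\<in>?Y - {z}. G y ` ?\<sigma>)"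
    \<comment> \<open>\<open>\<theta>\<close> winds once around the circle along the lift \<open>\<alpha>\<close> and is 1 elsewhere. A continuous logarithm of
      \<open>\<theta>\<close> changes by \<open>2 * pi * \<i>\<close> along \<open>\<alpha>\<close>, but not at all along the second lift, which has its ends
      in the same components.\<close>
    define \<theta> where "\<theta> x = (if x \<in> \<alpha> then exp (2 * of_real pi * \<i> * of_real (\<tau> (f x))) else 1)" for x
    have \<tau>exp: "exp (2 * of_real pi * \<i> * of_real (\<tau> w)) = 1" if "w \<in> cball p v \<union> cball q v" for w
    proof -
      have "\<tau> w = 0 \<or> \<tau> w = 1" using that \<tau> by blast
      then show ?thesis by (auto simp: exp_eq_1)
    qed
    have cont\<tau>: "continuous_on B (\<lambda>x. \<tau> (f x))" for B
      by (rule continuous_on_compose2[OF \<tau>(1) contf]) auto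
    have "continuous_on (\<alpha> \<union> R) \<theta>"
      unfolding \<theta>_def
    proof (rule continuous_on_cases)
      show "closed \<alpha>" unfolding \<alpha>_def by (rule compact_imp_closed[OF cG[OF z(1)]])
      show "closed R"
        unfolding R_def using contf finY cG
        by (intro closed_Un closed_UN ballI closed_Int closed_vimage compact_imp_closed) auto
      show "continuous_on \<alpha> (\<lambda>x. exp (2 * of_real pi * \<i> * of_real (\<tau> (f x))))"
        by (intro continuous_intros cont\<tau>)
      show "\<forall>x. x \<in> \<alpha> \<and> x \<notin> \<alpha> \<or> x \<in> R \<and> x \<in> \<alpha> \<longrightarrow> exp (2 * of_real pi * \<i> * of_real (\<tau> (f x))) = 1"
      proof (intro allI impI)
        fix x assume "x \<in> \<alpha> \<and> x \<notin> \<alpha> \<or> x \<in> R \<and> x \<in> \<alpha>"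
        then have x: "x \<in> R" "x \<in> \<alpha>" by auto
        have "x \<notin> (\<Union>y\<in>?Y - {z}. G y ` ?\<sigma>)"
          using disjG[OF _ z(1)] x(2) unfolding \<alpha>_def by blast
        then have "f x \<in> cball p v \<union> cball q v" using x(1) unfolding R_def by blast
        then show "exp (2 * of_real pi * \<i> * of_real (\<tau> (f x))) = 1" by (rule \<tau>exp)
      qed
    qed simp
    moreover have "X \<subseteq> \<alpha> \<union> R"
    proof
      fix x assume x: "x \<in> X"
      show "x \<in> \<alpha> \<union> R"
      proof (cases "f x \<in> ?\<sigma>")
        case True
        then obtain y where y: "y \<in> ?Y" "G y (f x) = x" using G(5)[of x] x Xball by blast
        then have "x \<in> G y ` ?\<sigma>" using True by (metis imageI)
        then show ?thesis using y(1) unfolding \<alpha>_def R_def by blast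
      next
        case False
        then show ?thesis using x unfolding R_def X_def A_def by blast
      qed
    qed
    ultimately have "continuous_on X \<theta>" by (rule continuous_on_subset)
    moreover have "\<theta> \<in> X \<rightarrow> - {0}" by (auto simp: \<theta>_def)
    ultimately obtain L where L: "continuous_on X L" "\<And>x. x \<in> X \<Longrightarrow> \<theta> x = exp (L x)"
      using \<open>Borsukian X\<close> unfolding Borsukian_continuous_logarithm by blast
    have const: "L x = L y" if "connected E" "E \<subseteq> X" "\<And>x. x \<in> E \<Longrightarrow> \<theta> x = 1" "x \<in> E" "y \<in> E" for E x y
      by (rule exp_eq_1_imp_constant[OF that(1) continuous_on_subset[OF L(1) that(2)] _ that(4,5)])
        (use L(2) that(2,3) in \<open>metis subsetD\<close>)
    have \<theta>1: "\<theta> x = 1" if "f x \<in> cball p v \<union> cball q v" for x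
      using \<tau>exp[OF that] by (simp add: \<theta>_def)
    have comp: "L x = L y" if "B \<subseteq> ball a \<rho> \<inter> f -` (ball p v \<union> ball q v)" "connected B" "x \<in> B" "y \<in> B" for B x y
    proof (rule const[OF that(2) _ _ that(3,4)])
      show "B \<subseteq> X" using that(1) unfolding X_def A_def by fastforce
      show "\<theta> x = 1" if "x \<in> B" for x
        by (rule \<theta>1) (use \<open>x \<in> B\<close> \<open>B \<subseteq> ball a \<rho> \<inter> f -` (ball p v \<union> ball q v)\<close> in fastforce)
    qed
    have "L z = L z'"
    proof (rule comp)
      show "?I z \<subseteq> ball a \<rho> \<inter> f -` (ball p v \<union> ball q v)"
        using connected_component_subset[of "ball a \<rho> \<inter> f -` ball p v" z] by blast
      show "z \<in> ?I z" using end0[OF z(1)] by simp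
      show "z' \<in> ?I z" using end0[OF z(2)] z(3) by simp
    qed simp
    moreover have "L (G z p1) = L (G z' p1)"
    proof (rule comp)
      show "?J z \<subseteq> ball a \<rho> \<inter> f -` (ball p v \<union> ball q v)"
        using connected_component_subset[of "ball a \<rho> \<inter> f -` ball q v" "G z p1"] by blast
      show "G z p1 \<in> ?J z" using end1[OF z(1)] by simp
      show "G z' p1 \<in> ?J z" using end1[OF z(2)] z(3) by simp
    qed simp
    moreover have "L z' = L (G z' p1)"
    proof (rule const)
      show "connected (G z' ` ?\<sigma>)"
        by (intro connected_continuous_image G(1) z) auto
      show "G z' ` ?\<sigma> \<subseteq> X" using GX z by blast
      show "\<theta> x = 1" if "x \<in> G z' ` ?\<sigma>" for x
        using disjG[OF z(1,2) \<open>z \<noteq> z'\<close>] that unfolding \<theta>_def \<alpha>_def by auto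
      show "z' \<in> G z' ` ?\<sigma>" using G(2)[OF z(2)] by (metis ends_in_segment(1) imageI)
    qed simp
    \<comment> \<open>Along the first lift both terms are logarithms of \<open>\<theta>\<close>, so
      \<open>L\<close> gains \<open>2 * pi * \<i>\<close>; by the previous equalities it gains
      nothing.\<close>
    moreover have "L (G z p0) - 2 * of_real pi * \<i> * of_real (\<tau> p0) = L (G z p1) - 2 * of_real pi * \<i> * of_real (\<tau> p1)"
    proof (rule exp_eq_1_imp_constant[of ?\<sigma> "\<lambda>w. L (G z w) - 2 * of_real pi * \<i> * of_real (\<tau> w)"])
      have "continuous_on ?\<sigma> (\<lambda>w. L (G z w))"
        by (rule continuous_on_compose2[OF L(1) G(1)[OF z(1)]]) (use GX z in auto)
      moreover have "continuous_on ?\<sigma> \<tau>" using \<tau>(1) continuous_on_subset by blast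
      ultimately show "continuous_on ?\<sigma> (\<lambda>w. L (G z w) - 2 * of_real pi * \<i> * of_real (\<tau> w))"
        by (intro continuous_intros)
      fix w assume w: "w \<in> ?\<sigma>"
      have "exp (L (G z w)) = exp (2 * of_real pi * \<i> * of_real (\<tau> w))"
        using L(2)[OF GX[OF z(1) w]] w G(4)[OF z(1) w] by (simp add: \<theta>_def \<alpha>_def)
      then show "exp (L (G z w) - 2 * of_real pi * \<i> * of_real (\<tau> w)) = 1" by (simp add: exp_diff)
    qed auto
    ultimately show False
      using \<tau>(2)[OF p01(1)] \<tau>(3)[OF p01(2)] G(2)[OF z(1)] by simp
  qed
  show ?thesis
  proof (rule that[of "?I ` S'" "?J ` S'"])
    show "?I ` S' \<subseteq> components (ball a \<rho> \<inter> f -` ball p v)"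
      using end0 S'(1) by (intro image_subsetI componentsI) blast
    show "?J ` S' \<subseteq> components (ball a \<rho> \<inter> f -` ball q v)"
      using end1 S'(1) by (intro image_subsetI componentsI) blast
    have "card S = card ((\<lambda>z. (?I z, ?J z)) ` S')"
      using card_image[OF inj_on_subset[OF inj S'(1)]] S'(3) by simp
    also have "\<dots> \<le> card (?I ` S' \<times> ?J ` S')"
      using S'(2) by (intro card_mono) auto
    finally show "card S \<le> card (?I ` S') * card (?J ` S')"
      by (simp add: card_cartesian_product)
  qed (use S' in auto)
qed

section \<open>Entropy from a large fibre\<close>

text \<open>A frontier point of \<open>U\<close> with value in \<open>ball p v\<close> would have to
  be on the sphere, where the modulus is at least \<open>C\<close> and thus too large. The frontier
  hypothesis fits single components as well as the whole preimage.\<close>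

lemma island_in_preimage:
  assumes f: "f holomorphic_on UNIV" and "v > 0"
    and sph: "\<And>z. z \<in> sphere a \<rho> \<Longrightarrow> C \<le> cmod (f z)" and p: "cmod p + v \<le> C"
    and U: "open U" "U \<noteq> {}" "U \<subseteq> ball a \<rho> \<inter> f -` ball p v"
      "frontier U \<subseteq> frontier (ball a \<rho> \<inter> f -` ball p v)"
  shows "island f U p v"
proof -
  let ?\<Omega> = "ball a \<rho> \<inter> f -` ball p v"
  have contf: "continuous_on A f" and holf: "f holomorphic_on A" for A
    using f by (meson holomorphic_on_imp_continuous_on holomorphic_on_subset subset_UNIV)+
  have "open ?\<Omega>" using contf by (intro open_Int open_vimage) auto
  have fr: "f z \<notin> ball p v" if "z \<in> frontier U" for z
  proof
    assume fz: "f z \<in> ball p v"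
    have "frontier ?\<Omega> = closure ?\<Omega> - ?\<Omega>"
      by (simp only: frontier_def interior_open[OF \<open>open ?\<Omega>\<close>])
    then have "z \<in> closure ?\<Omega>" "z \<notin> ?\<Omega>"
      using that U(4) by blast+
    then have "z \<in> sphere a \<rho>"
      using fz closure_mono[of ?\<Omega> "cball a \<rho>"] by (force simp: order_le_less)
    then have "C \<le> cmod (f z)" by (rule sph)
    moreover have "cmod (f z) < C"
      using fz p norm_triangle_sub[of "f z" p] by (simp add: dist_norm norm_minus_commute)
    ultimately show False by simp
  qed
  have bU: "bounded U" using U(3) bounded_ball bounded_subset by blast
  obtain t where t: "t \<in> U" "f t \<in> ball p v" using U(2,3) by blast
  have "ball p v \<subseteq> f ` U"
    by (rule ball_subset_holomorphic_image[OF U(1) bU holf contf t fr])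
  then have "p \<in> f ` U" using \<open>v > 0\<close> by auto
  moreover have "v \<le> cmod (f z - p)" if "z \<in> frontier U" for z
    using fr[OF that] by (simp add: dist_norm norm_minus_commute)
  ultimately show ?thesis using U(1) bU by (simp add: island_def)
qed

text \<open>The product bound yields \<open>M\<close> components over the disc about 0 or over the
  one about \<open>b\<close>, and the itinerary is constant or periodic accordingly. The point
  \<open>z1\<close> ensures that \<open>f\<close> maps the disc about \<open>b\<close> over
  \<open>ball 0 C\<close>.\<close>

lemma htop_henon_ge:
  assumes f: "f holomorphic_on UNIV" "\<not> f constant_on UNIV" and "\<rho> > 0"
    and v: "v = 2 * (1 + cmod \<delta>) * \<rho>" and b: "2 * v < cmod b"
    and C: "cmod b + v < C" "cmod (\<delta> * b) + v \<le> C"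
    and sph: "\<And>z. z \<in> sphere 0 \<rho> \<Longrightarrow> C \<le> cmod (f z)" "\<And>z. z \<in> sphere b \<rho> \<Longrightarrow> C \<le> cmod (f z)"
    and S: "finite S" "S \<subseteq> ball 0 \<rho>" "\<And>s. s \<in> S \<Longrightarrow> f s = c" "c \<in> ball 0 v" "M * M \<le> card S" "M > 0"
    and z1: "z1 \<in> ball b \<rho>" "cmod (f z1) < C"
  shows "htop (UNIV :: (complex \<times> complex) set) (henon_map f \<delta>) \<ge> ereal (ln (real M) / real 3)"
proof -
  have contf: "continuous_on A f" and holf: "f holomorphic_on A" for A
    using f by (meson holomorphic_on_imp_continuous_on holomorphic_on_subset subset_UNIV)+
  have "v > 0" unfolding v using \<open>\<rho> > 0\<close> by (intro mult_pos_pos) (auto intro: add_pos_nonneg)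
  have op: "open (ball a \<rho> \<inter> f -` ball p v)" for a p
    using contf by (intro open_Int open_vimage) auto
  \<comment> \<open>One value of modulus below \<open>C\<close> forces \<open>f\<close> to map the
    disc over \<open>ball 0 C\<close>, so the preimage of \<open>ball p v\<close> is non-empty and
    an island.\<close>
  have whole: "island f (ball a \<rho> \<inter> f -` ball p v) p v"
    if "\<And>z. z \<in> sphere a \<rho> \<Longrightarrow> C \<le> cmod (f z)" "cmod p + v \<le> C" "t \<in> ball a \<rho>" "cmod (f t) < C" for a p t
  proof (rule island_in_preimage[OF f(1) \<open>v > 0\<close> that(1,2) op])
    have "ball 0 C \<subseteq> f ` ball a \<rho>"
    proof (rule ball_subset_holomorphic_image[OF _ _ holf contf that(3)])
      show "f x \<notin> ball 0 C" if "x \<in> frontier (ball a \<rho>)" for x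
        using \<open>\<rho> > 0\<close> that \<open>\<And>z. z \<in> sphere a \<rho> \<Longrightarrow> C \<le> cmod (f z)\<close>[of x] by (simp add: frontier_ball)
    qed (use that in auto)
    moreover have "p \<in> ball 0 C" using that(2) \<open>v > 0\<close> by simp
    ultimately obtain t where "t \<in> ball a \<rho>" "f t = p" by blast
    then show "ball a \<rho> \<inter> f -` ball p v \<noteq> {}" using \<open>v > 0\<close> by auto
  qed auto
  have "S \<noteq> {}" using S(5,6) by auto
  then obtain s where s: "s \<in> ball 0 \<rho>" "f s = c" using S by blast
  have "cmod c < v" using S(4) by simp
  then have sC: "cmod (f s) < C" using s(2) C(1) b \<open>v > 0\<close> by simp
  have disc: "cball 0 v \<subseteq> ball 0 C" "cball b v \<subseteq> ball 0 C" "cball 0 v \<inter> cball b v = {}"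
  proof -
    show "cball 0 v \<subseteq> ball 0 C" using C(1) b norm_ge_zero[of b] by (auto simp del: norm_ge_zero)
    show "cball b v \<subseteq> ball 0 C"
    proof
      fix x assume "x \<in> cball b v"
      then have "cmod x \<le> cmod b + v"
        using norm_triangle_sub[of x b] by (simp add: dist_norm norm_minus_commute)
      then show "x \<in> ball 0 C" using C(1) by simp
    qed
    show "cball 0 v \<inter> cball b v = {}" by (rule disjoint_cballI) (use b in simp)
  qed
  have vC: "cmod 0 + v \<le> C" using C(1) norm_ge_zero[of b] unfolding norm_zero by linarith
  obtain A B where AB: "finite A" "A \<subseteq> components (ball 0 \<rho> \<inter> f -` ball 0 v)"
    "finite B" "B \<subseteq> components (ball 0 \<rho> \<inter> f -` ball b v)" "card S \<le> card A * card B"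
    by (rule card_fibre_le_components[OF f \<open>\<rho> > 0\<close> sph(1) disc S(1-4)])
  \<comment> \<open>\<open>b' = 0\<close> gives the constant itinerary, \<open>b' = b\<close> the
    one of period 3. Single components serve at the positions with a choice, whole preimages at the
    others.\<close>
  have main: ?thesis
    if b': "b' = 0 \<or> b' = b" and D: "finite D" "D \<subseteq> components (ball 0 \<rho> \<inter> f -` ball b' v)" "M \<le> card D" for b' D
  proof -
    obtain D' where D': "D' \<subseteq> D" "finite D'" "card D' = M"
      using obtain_subset_with_card_n[OF D(3)] by metis
    then obtain U where U: "bij_betw U {0..<M} D'"
      using ex_bij_betw_nat_finite by blast
    have UD: "U i \<in> components (ball 0 \<rho> \<inter> f -` ball b' v)" if "i < M" for i
    proof -
      have "U i \<in> D'" using bij_betwE[OF U] that by simp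
      then show ?thesis using D'(1) D(2) by blast
    qed
    have b'C: "cmod b' + v \<le> C" "cmod (\<delta> * b') + v \<le> C"
    proof -
      show "cmod b' + v \<le> C" "cmod (\<delta> * b') + v \<le> C" using b' C vC by auto
    qed
    show ?thesis
    proof (rule htop_henon_ge_islands[OF f(1) \<open>\<rho> > 0\<close> eq_refl[OF v[symmetric]] \<open>M > 0\<close>, of U b'
          "ball b' \<rho> \<inter> f -` ball 0 v" "ball 0 \<rho> \<inter> f -` ball (\<delta> * b') v"])
      fix i assume i: "i < M"
      have "island f (U i) b' v"
      proof (rule island_in_preimage[OF f(1) \<open>v > 0\<close> sph(1) b'C(1)])
        show "open (U i)" by (rule open_components[OF op UD[OF i]])
        show "U i \<noteq> {}" by (rule in_components_nonempty[OF UD[OF i]])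
        show "U i \<subseteq> ball 0 \<rho> \<inter> f -` ball b' v" by (rule in_components_subset[OF UD[OF i]])
        show "frontier (U i) \<subseteq> frontier (ball 0 \<rho> \<inter> f -` ball b' v)"
          by (rule frontier_of_components_subset[OF UD[OF i]])
      qed
      then show "island f (U i) b' v \<and> U i \<subseteq> ball 0 \<rho>"
        using in_components_subset[OF UD[OF i]] by blast
    next
      fix i j assume ij: "i < M" "j < M" "i \<noteq> j"
      then have "U i \<noteq> U j" using U by (auto simp: bij_betw_def inj_on_def)
      then show "U i \<inter> U j = {}"
        using components_nonoverlap[OF UD[OF ij(1)] UD[OF ij(2)]] by blast
    next
      show "island f (ball b' \<rho> \<inter> f -` ball 0 v) 0 v"
        using b'
      proof
        assume "b' = 0"
        then show ?thesis using whole[OF sph(1) vC s(1) sC] by simp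
      next
        assume "b' = b"
        then show ?thesis using whole[OF sph(2) vC z1] by simp
      qed
      show "island f (ball 0 \<rho> \<inter> f -` ball (\<delta> * b') v) (\<delta> * b') v"
        by (rule whole[OF sph(1) b'C(2) s(1) sC])
    qed auto
  qed
  have "M \<le> card A \<or> M \<le> card B"
  proof (rule ccontr)
    assume "\<not> ?thesis"
    then have "card A * card B < M * M" by (intro mult_strict_mono) auto
    then show False using AB(5) S(5) by simp
  qed
  then show ?thesis using main[of 0 A] main[of b B] AB by blast
qed

section \<open>Spherical limits of entire functions\<close>

text \<open>The triangle inequality through infinity: \<open>sqrt (1 + t\<^sup>2)\<close> is the
  norm of the vector (1, t), hence 1-Lipschitz in \<open>t\<close>.\<close>

lemma infinity_dist_lipschitz:
  "\<bar>chordal_dist (Some a) None - chordal_dist x None\<bar> \<le> chordal_dist (Some a) x"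
proof (cases x)
  case (Some b)
  define A B where "A = sqrt (1 + (cmod a)\<^sup>2)" and "B = sqrt (1 + (cmod b)\<^sup>2)"
  have AB: "A > 0" "B > 0" by (simp_all add: A_def B_def add_pos_nonneg)
  have "A = cmod (Complex 1 (cmod a))" "B = cmod (Complex 1 (cmod b))"
    by (simp_all add: A_def B_def complex_norm)
  then have "\<bar>B - A\<bar> \<le> cmod (Complex 1 (cmod b) - Complex 1 (cmod a))"
    by (metis norm_triangle_ineq3)
  also have "\<dots> = \<bar>cmod b - cmod a\<bar>"
  proof -
    have "Complex 1 (cmod b) - Complex 1 (cmod a) = Complex 0 (cmod b - cmod a)"
      by (simp add: complex_eq_iff)
    then show ?thesis by (simp add: complex_norm)
  qed
  also have "\<dots> \<le> cmod (a - b)"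
    by (metis norm_minus_commute norm_triangle_ineq3)
  finally have 1: "\<bar>B - A\<bar> \<le> cmod (a - b)" .
  have "2 / A - 2 / B = 2 * (B - A) / (A * B)"
    using AB by (simp add: field_simps)
  then have "\<bar>2 / A - 2 / B\<bar> = 2 * \<bar>B - A\<bar> / (A * B)"
    using AB by (simp only: abs_mult abs_divide abs_of_pos abs_numeral)
  also have "\<dots> \<le> 2 * cmod (a - b) / (A * B)"
    using AB 1 by (intro divide_right_mono) auto
  finally show ?thesis by (simp add: Some A_def B_def)
qed auto

text \<open>The chart \<open>1 / z\<close> at infinity. \<open>Some 0\<close> is also sent to 0, so
  the chart is used only where finite values have modulus at least 1.\<close>

definition inverse_opt :: "complex option \<Rightarrow> complex" where
  "inverse_opt x = (case x of None \<Rightarrow> 0 | Some b \<Rightarrow> inverse b)"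

text \<open>Turns spherical convergence near infinity into uniform convergence of reciprocals. Each
  factor \<open>sqrt (1 + (cmod c)\<^sup>2)\<close> is at most \<open>sqrt 2 * cmod c\<close>, and
  the two constants cancel the 2 of the chordal distance.\<close>

lemma inverse_opt_dist:
  assumes "1 \<le> cmod a" "\<And>b. x = Some b \<Longrightarrow> 1 \<le> cmod b"
  shows "cmod (inverse a - inverse_opt x) \<le> chordal_dist (Some a) x"
proof -
  have le: "sqrt (1 + (cmod c)\<^sup>2) \<le> sqrt 2 * cmod c" if "1 \<le> cmod c" for c :: complex
  proof -
    have "1 \<le> (cmod c)\<^sup>2" using that by simp
    then have "sqrt (1 + (cmod c)\<^sup>2) \<le> sqrt (2 * (cmod c)\<^sup>2)" by (intro real_sqrt_le_mono) linarith
    then show ?thesis by (simp add: real_sqrt_mult)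
  qed
  have pos: "sqrt (1 + (cmod c)\<^sup>2) > 0" for c :: complex by (simp add: add_pos_nonneg)
  have a0: "cmod a > 0" using assms(1) by linarith
  show ?thesis
  proof (cases x)
    case None
    have "sqrt 2 * cmod a \<le> 2 * cmod a"
      by (rule mult_right_mono) (use sqrt2_less_2 in auto)
    then have "sqrt (1 + (cmod a)\<^sup>2) \<le> 2 * cmod a"
      using le[OF assms(1)] by linarith
    then have "1 / cmod a \<le> 2 / sqrt (1 + (cmod a)\<^sup>2)"
      using a0 pos[of a] by (simp add: field_simps)
    then show ?thesis by (simp add: None inverse_opt_def norm_inverse norm_divide inverse_eq_divide)
  next
    case (Some b)
    then have b: "1 \<le> cmod b" using assms(2) by simp
    then have nz: "a \<noteq> 0" "b \<noteq> 0" and b0: "cmod b > 0" using a0 by auto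
    have "inverse a - inverse b = (b - a) / (a * b)" using nz by (simp add: field_simps)
    then have "cmod (inverse a - inverse b) = cmod (a - b) / (cmod a * cmod b)"
      by (simp add: norm_divide norm_mult norm_minus_commute)
    also have "\<dots> = 2 * cmod (a - b) / (2 * (cmod a * cmod b))" by simp
    also have "\<dots> \<le> 2 * cmod (a - b) / (sqrt (1 + (cmod a)\<^sup>2) * sqrt (1 + (cmod b)\<^sup>2))"
    proof (rule divide_left_mono)
      have "sqrt (1 + (cmod a)\<^sup>2) * sqrt (1 + (cmod b)\<^sup>2) \<le> (sqrt 2 * cmod a) * (sqrt 2 * cmod b)"
        using le[OF assms(1)] le[OF b] by (intro mult_mono) auto
      also have "\<dots> = (sqrt 2 * sqrt 2) * (cmod a * cmod b)" by (simp only: ac_simps)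
      finally show "sqrt (1 + (cmod a)\<^sup>2) * sqrt (1 + (cmod b)\<^sup>2) \<le> 2 * (cmod a * cmod b)"
        by simp
    qed (use pos a0 b0 in \<open>auto intro!: mult_pos_pos\<close>)
    finally show ?thesis by (simp add: Some inverse_opt_def)
  qed
qed

lemma infinity_dist_lt_1_imp: "chordal_dist (Some b) None < 1 \<Longrightarrow> 1 \<le> cmod b"
proof (rule ccontr)
  assume *: "chordal_dist (Some b) None < 1" "\<not> 1 \<le> cmod b"
  then have "(cmod b)\<^sup>2 < 1" by (simp add: power_less_one_iff abs_square_less_1)
  then have "sqrt (1 + (cmod b)\<^sup>2) < sqrt 4" by (intro real_sqrt_less_mono) linarith
  then have "sqrt (1 + (cmod b)\<^sup>2) < 2" by simp
  moreover have "sqrt (1 + (cmod b)\<^sup>2) > 0" by (simp add: add_pos_nonneg)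
  ultimately show False using *(1) by (simp add: field_simps)
qed

text \<open>Reduces spherical convergence to uniform convergence of real functions whose limit
  vanishes exactly where \<open>h\<close> is infinite.\<close>

lemma spherical_limit_infinity_dist:
  assumes "spherical_lu_conv U g h" "compact K" "K \<subseteq> U"
  shows "uniform_limit K (\<lambda>k z. chordal_dist (Some (g k z)) None) (\<lambda>z. chordal_dist (h z) None) sequentially"
proof (rule uniform_limitI)
  fix e :: real assume "e > 0"
  then have "eventually (\<lambda>k. \<forall>z\<in>K. chordal_dist (Some (g k z)) (h z) < e) sequentially"
    using assms unfolding spherical_lu_conv_def by blast
  then show "eventually (\<lambda>k. \<forall>z\<in>K. dist (chordal_dist (Some (g k z)) None) (chordal_dist (h z) None) < e) sequentially"
    by eventually_elim (metis dist_real_def infinity_dist_lipschitz le_less_trans)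
qed

lemma chordal_dist_infinity_nonneg: "0 \<le> chordal_dist x None"
  by (cases x) auto

lemma chordal_dist_infinity_eq_0: "chordal_dist x None = 0 \<longleftrightarrow> x = None"
  by (cases x) (auto simp: add_nonneg_eq_0_iff)

lemma spherical_limit_continuous:
  assumes g: "\<And>k. g k holomorphic_on UNIV" and "spherical_lu_conv U g h" "open U"
  shows "continuous_on U (\<lambda>z. chordal_dist (h z) None)"
proof -
  have cg: "continuous_on A (\<lambda>z. chordal_dist (Some (g k z)) None)" for A k
  proof -
    have "continuous_on A (g k)" using g by (meson holomorphic_on_imp_continuous_on holomorphic_on_subset subset_UNIV)
    moreover have "sqrt (1 + (cmod w)\<^sup>2) \<noteq> 0" for w :: complex
      by (simp add: add_nonneg_eq_0_iff)
    ultimately show ?thesis by (auto intro!: continuous_intros)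
  qed
  have "isCont (\<lambda>z. chordal_dist (h z) None) z0" if z0: "z0 \<in> U" for z0
  proof -
    obtain r where r: "r > 0" "cball z0 r \<subseteq> U" using assms(3) z0 open_contains_cball by blast
    have "continuous_on (cball z0 r) (\<lambda>z. chordal_dist (h z) None)"
      by (rule uniform_limit_theorem[OF _ spherical_limit_infinity_dist[OF assms(2) compact_cball r(2)]])
        (auto intro!: cg always_eventually simp del: chordal_dist.simps)
    then have "continuous_on (ball z0 r) (\<lambda>z. chordal_dist (h z) None)"
      by (rule continuous_on_subset) auto
    then show ?thesis using r(1) by (simp add: continuous_on_eq_continuous_at)
  qed
  then show ?thesis by (simp add: continuous_at_imp_continuous_on)
qed

text \<open>The points with infinite limit form a closed set by continuity of the distance to
  infinity, and an open one by Hurwitz applied to the reciprocals.\<close>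

lemma spherical_limit_dichotomy:
  assumes g: "\<And>k. g k holomorphic_on UNIV" and conv: "spherical_lu_conv U g h"
    and U: "open U" "connected U"
  shows "(\<forall>z\<in>U. h z = None) \<or> (\<forall>z\<in>U. h z \<noteq> None)"
proof -
  let ?m = "\<lambda>z. chordal_dist (h z) None"
  let ?N = "{z \<in> U. h z = None}"
  have cm: "continuous_on U ?m" by (rule spherical_limit_continuous[OF g conv U(1)])
  have "closedin (top_of_set U) {z \<in> U. ?m z = 0}"
    using continuous_closedin_preimage_constant[OF cm, of 0] .
  then have "closedin (top_of_set U) ?N" by (simp only: chordal_dist_infinity_eq_0)
  moreover have "\<exists>r>0. ball z0 r \<subseteq> ?N" if z0: "z0 \<in> ?N" for z0
  proof -
    have "isCont ?m z0" using cm U(1) z0 by (simp add: continuous_on_eq_continuous_at)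
    then have "\<forall>e>0. \<exists>d>0. \<forall>z. dist z z0 < d \<longrightarrow> dist (?m z) (?m z0) < e"
      by (simp only: continuous_at_eps_delta)
    then have "\<exists>d>0. \<forall>z. dist z z0 < d \<longrightarrow> dist (?m z) (?m z0) < 1 / 2"
      by (rule allE[of _ "1 / 2"]) simp
    moreover have "?m z0 = 0" using z0 by simp
    ultimately obtain d where d: "d > 0" "\<And>z. dist z z0 < d \<Longrightarrow> \<bar>?m z\<bar> < 1 / 2"
      by (metis diff_0_right dist_real_def)
    obtain r0 where r0: "r0 > 0" "cball z0 r0 \<subseteq> U" using U(1) z0 open_contains_cball by blast
    define r where "r = min r0 (d / 2)"
    have r: "r > 0" "cball z0 r \<subseteq> U" using r0 d(1) by (auto simp: r_def)
    have mr: "?m z < 1 / 2" if "z \<in> cball z0 r" for z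
      using d(2)[of z] that d(1) by (auto simp: r_def dist_commute)
    have "eventually (\<lambda>k. \<forall>z\<in>cball z0 r. dist (chordal_dist (Some (g k z)) None) (?m z) < 1 / 2) sequentially"
      using uniform_limitD[OF spherical_limit_infinity_dist[OF conv compact_cball r(2)], of "1/2"] by simp
    then obtain k0 where k0: "\<And>k z. \<lbrakk>k \<ge> k0; z \<in> cball z0 r\<rbrakk> \<Longrightarrow> dist (chordal_dist (Some (g k z)) None) (?m z) < 1 / 2"
      unfolding eventually_sequentially by blast
    \<comment> \<open>Two errors below 1/2 stay below the threshold 1 of
      \<open>infinity_dist_lt_1_imp\<close>.\<close>
    have large: "1 \<le> cmod (g k z)" if "k \<ge> k0" "z \<in> cball z0 r" for k z
    proof (rule infinity_dist_lt_1_imp)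
      show "chordal_dist (Some (g k z)) None < 1"
        using k0[OF that] mr[OF that(2)] unfolding dist_real_def by linarith
    qed
    have hlarge: "1 \<le> cmod b" if "z \<in> cball z0 r" "h z = Some b" for z b
      using mr[OF that(1)] by (intro infinity_dist_lt_1_imp) (simp add: that(2) del: chordal_dist.simps)
    \<comment> \<open>The shift by \<open>k0\<close> makes every reciprocal in the sequence
      holomorphic.\<close>
    define F where "F k z = inverse (g (k + k0) z)" for k z
    let ?u = "\<lambda>z. inverse_opt (h z)"
    have Fnz: "F k z \<noteq> 0" if "z \<in> cball z0 r" for k z
      using large[of "k + k0" z] that by (auto simp: F_def)
    have holF: "F k holomorphic_on cball z0 r" for k
    proof -
      have "g (k + k0) holomorphic_on cball z0 r" using g holomorphic_on_subset by blast
      then have "(\<lambda>z. inverse (g (k + k0) z)) holomorphic_on cball z0 r"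
        by (rule holomorphic_on_inverse) (use large[of "k + k0"] in force)
      then show ?thesis by (simp add: F_def[abs_def])
    qed
    have lim: "uniform_limit (cball z0 r) F ?u sequentially"
    proof (rule uniform_limitI)
      fix e :: real assume "e > 0"
      then have "eventually (\<lambda>k. \<forall>z\<in>cball z0 r. chordal_dist (Some (g k z)) (h z) < e) sequentially"
        using conv[unfolded spherical_lu_conv_def, rule_format, of "cball z0 r" e] r(2) compact_cball by simp
      then have "eventually (\<lambda>k. \<forall>z\<in>cball z0 r. chordal_dist (Some (g (k + k0) z)) (h z) < e) sequentially"
        by (rule sequentially_offset)
      then show "eventually (\<lambda>k. \<forall>z\<in>cball z0 r. dist (F k z) (?u z) < e) sequentially"
      proof eventually_elim
        case (elim k)
        show ?case
        proof
          fix z assume z: "z \<in> cball z0 r"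
          have "cmod (inverse (g (k + k0) z) - inverse_opt (h z)) \<le> chordal_dist (Some (g (k + k0) z)) (h z)"
            by (rule inverse_opt_dist) (use large[of "k + k0" z] hlarge z in auto)
          also have "\<dots> < e" using elim z by (rule bspec)
          finally show "dist (F k z) (?u z) < e" unfolding F_def dist_norm .
        qed
      qed
    qed
    have holF': "F k holomorphic_on ball z0 r" for k
      by (rule holomorphic_on_subset[OF holF]) auto
    have holu: "?u holomorphic_on ball z0 r"
      by (rule holomorphic_uniform_limit[OF _ lim])
        (use holF holF' in \<open>auto intro!: always_eventually holomorphic_on_imp_continuous_on\<close>)
    \<comment> \<open>A limit of zero-free holomorphic functions is zero-free or constant, and this
      one vanishes at \<open>z0\<close>.\<close>
    have "?u constant_on ball z0 r"
    proof (rule ccontr)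
      assume nc: "\<not> ?thesis"
      have "?u z0 \<noteq> 0"
      proof (rule Hurwitz_no_zeros[OF open_ball connected_ball _ holu _ nc])
        show "F k holomorphic_on ball z0 r" for k by (rule holF')
        show "uniform_limit K F ?u sequentially" if "compact K" "K \<subseteq> ball z0 r" for K
          using uniform_limit_on_subset[OF lim] that ball_subset_cball by blast
      qed (use Fnz r(1) in auto)
      then show False using z0 by (simp add: inverse_opt_def)
    qed
    moreover have "?u z0 = 0" "z0 \<in> ball z0 r" using z0 r(1) by (auto simp: inverse_opt_def)
    ultimately have u0: "?u z = 0" if "z \<in> ball z0 r" for z
      using that unfolding constant_on_def by metis
    \<comment> \<open>Vanishing of \<open>inverse_opt\<close> means infinity here, since
      \<open>hlarge\<close> excludes the value \<open>Some 0\<close>.\<close>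
    have "h z = None" if z: "z \<in> ball z0 r" for z
    proof (cases "h z")
      case (Some b)
      then have "b = 0" using u0[OF z] by (simp add: inverse_opt_def)
      moreover have "1 \<le> cmod b" using hlarge[of z b] z Some by auto
      ultimately show ?thesis by simp
    qed
    then show ?thesis using r by (intro exI[of _ r]) (use ball_subset_cball in blast)
  qed
  then have "open ?N" unfolding open_contains_ball by blast
  then have "openin (top_of_set U) ?N" by (intro open_subset) auto
  ultimately have "?N = {} \<or> ?N = U"
    using U(2) connected_clopen by blast
  then show ?thesis
  proof
    assume "?N = {}"
    then have "\<forall>z\<in>U. h z \<noteq> None" unfolding set_eq_iff by simp
    then show ?thesis ..
  next
    assume "?N = U"
    then have "\<forall>z\<in>U. h z = None" by (auto simp: set_eq_iff)
    then show ?thesis ..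
  qed
qed

section \<open>Rescalings of transcendental entire functions\<close>

lemma transcendental_not_constant:
  assumes "transcendental_entire f"
  shows "\<not> f constant_on UNIV"
proof
  assume "f constant_on UNIV"
  then obtain d where "\<And>z. f z = poly [:d:] z" by (auto simp: constant_on_def)
  then show False using assms unfolding transcendental_entire_def by blast
qed

text \<open>Great Picard for \<open>f (inverse z)\<close> at 0. A limit there would make
  \<open>f\<close> constant by Liouville, and a limit of the reciprocal would make it a polynomial,
  so the singularity is essential.\<close>

lemma transcendental_infinite_fibre:
  assumes "transcendental_entire f"
  shows "\<exists>c. infinite {z. f z = c}"
proof -
  have hol: "f holomorphic_on UNIV" and np: "\<not> (\<exists>p. \<forall>z. f z = poly p z)"
    using assms by (auto simp: transcendental_entire_def)
  let ?g = "\<lambda>z. f (inverse z)"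
  have holg: "?g holomorphic_on UNIV - {0}"
    by (rule holomorphic_on_entire_compose[OF hol]) (auto intro!: holomorphic_intros)
  have 1: "\<not> (?g \<longlongrightarrow> l) (at 0)" for l
  proof
    assume "(?g \<longlongrightarrow> l) (at 0)"
    then have "(f \<longlongrightarrow> l) at_infinity"
      by (simp add: lim_at_infinity_0 o_def)
    then have "f z = poly [:l:] z" for z
      using Liouville_weak[OF hol] by simp
    then show False using np by blast
  qed
  have 2: "\<not> ((inverse \<circ> ?g) \<longlongrightarrow> l) (at 0)" for l
  proof
    assume "((inverse \<circ> ?g) \<longlongrightarrow> l) (at 0)"
    then have "((inverse \<circ> f) \<longlongrightarrow> l) at_infinity"
      by (simp add: lim_at_infinity_0 o_def)
    then obtain a n where an: "\<And>z. f z = (\<Sum>i\<le>n. a i * z ^ i)"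
      using pole_at_infinity[OF hol] by metis
    have "f z = poly (\<Sum>i\<le>n. monom (a i) i) z" for z
      by (simp add: an poly_sum poly_monom)
    then show False using np by blast
  qed
  obtain a where a: "\<And>w. w \<noteq> a \<Longrightarrow> infinite {x. x \<in> UNIV - {0} \<and> ?g x = w}"
    using great_Picard_infinite[OF open_UNIV UNIV_I holg 1 2] by metis
  \<comment> \<open>\<open>a\<close> is the possible exceptional value of Picard; any other value
    serves.\<close>
  have "infinite {z. f z = a + 1}"
  proof
    assume "finite {z. f z = a + 1}"
    then have "finite (inverse ` {z. f z = a + 1})" by simp
    moreover have "{x. x \<in> UNIV - {0} \<and> ?g x = a + 1} \<subseteq> inverse ` {z. f z = a + 1}"
    proof
      fix x assume "x \<in> {x. x \<in> UNIV - {0} \<and> ?g x = a + 1}"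
      then show "x \<in> inverse ` {z. f z = a + 1}"
        by (intro image_eqI[of _ _ "inverse x"]) auto
    qed
    ultimately show False using a[of "a + 1"] finite_subset by auto
  qed
  then show ?thesis by blast
qed

text \<open>The maximum principle carries the bound from the circles to the discs, Cauchy's
  inequality bounds \<open>deriv f\<close> by \<open>2 * B / R\<close> everywhere, and Liouville
  makes \<open>f\<close> affine.\<close>

lemma entire_linear_growth_on_circles:
  assumes hol: "f holomorphic_on UNIV" and "R > 0" "B \<ge> 0" and N: "filterlim N at_top sequentially"
    and bound: "eventually (\<lambda>k. \<forall>z. cmod z = R * real (N k) \<longrightarrow> cmod (f z) \<le> B * real (N k)) sequentially"
  shows "\<exists>p. \<forall>z. f z = poly p z"
proof -
  have "cmod (deriv f z) \<le> 2 * B / R" for z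
  proof -
    have "filterlim (\<lambda>k. real (N k)) at_top sequentially"
      by (rule filterlim_compose[OF filterlim_real_sequentially N])
    then have "eventually (\<lambda>k. real (N k) > 2 * cmod z / R) sequentially"
      by (simp add: filterlim_at_top_dense)
    with bound have "eventually (\<lambda>k. real (N k) > 2 * cmod z / R \<and>
        (\<forall>z. cmod z = R * real (N k) \<longrightarrow> cmod (f z) \<le> B * real (N k))) sequentially"
      by eventually_elim auto
    \<comment> \<open>This size of \<open>N k\<close> places the disc of radius
      \<open>R * n / 2\<close> about \<open>z\<close> inside the disc of radius \<open>R * n\<close>
      about 0.\<close>
    then obtain k where k: "real (N k) > 2 * cmod z / R"
      "\<And>z. cmod z = R * real (N k) \<Longrightarrow> cmod (f z) \<le> B * real (N k)"
      by (auto simp: eventually_sequentially)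
    define n where "n = real (N k)"
    have n: "R * n > 2 * cmod z" using k(1) \<open>R > 0\<close> by (simp add: n_def field_simps)
    then have Rn: "R * n > 0" using norm_ge_zero[of z] by linarith
    have in_disc: "cmod (f x) \<le> B * n" if "cmod x \<le> R * n" for x
    proof (rule maximum_modulus_frontier[of f "cball 0 (R * n)"])
      show "f holomorphic_on interior (cball 0 (R * n))" using hol holomorphic_on_subset by blast
      show "continuous_on (closure (cball 0 (R * n))) f"
        using hol by (meson holomorphic_on_imp_continuous_on holomorphic_on_subset subset_UNIV)
      show "cmod (f w) \<le> B * n" if "w \<in> frontier (cball 0 (R * n))" for w
        using that k(2)[of w] by (simp add: frontier_cball n_def)
    qed (use that in auto)
    have "cmod ((deriv ^^ 1) f z) \<le> fact 1 * (B * n) / (R * n / 2) ^ 1"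
    proof (rule Cauchy_inequality)
      show "f holomorphic_on ball z (R * n / 2)" using hol holomorphic_on_subset by blast
      show "continuous_on (cball z (R * n / 2)) f"
        using hol by (meson holomorphic_on_imp_continuous_on holomorphic_on_subset subset_UNIV)
      show "0 < R * n / 2" using Rn by simp
      show "cmod (f x) \<le> B * n" if "cmod (z - x) = R * n / 2" for x
      proof (rule in_disc)
        have "cmod x \<le> cmod z + cmod (z - x)"
          using norm_triangle_sub[of x z] by (simp add: norm_minus_commute)
        then show "cmod x \<le> R * n" using that n by linarith
      qed
    qed
    also have "\<dots> = 2 * B / R" using Rn \<open>R > 0\<close> by (auto simp: field_simps)
    finally show ?thesis by simp
  qed
  then have "bounded (range (deriv f))" unfolding bounded_iff by blast
  then have "deriv f constant_on UNIV"
    by (intro Liouville_theorem holomorphic_deriv[OF hol]) auto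
  then obtain d where d: "\<And>z. deriv f z = d"
    unfolding constant_on_def by auto
  have "((\<lambda>z. f z - d * z) has_field_derivative 0) (at z)" for z
    using holomorphic_derivI[OF hol open_UNIV UNIV_I, of z] d
    by (auto intro!: derivative_eq_intros)
  then have "\<exists>c. \<forall>z\<in>UNIV. f z - d * z = c"
    by (intro has_field_derivative_zero_constant) auto
  then obtain c where "\<And>z. f z = poly [:c, d:] z"
    by (auto simp: algebra_simps)
  then show ?thesis by blast
qed

text \<open>A limit finite at one point off \<open>Q\<close> is finite everywhere off
  \<open>Q\<close> by the dichotomy, hence bounded on a circle missing \<open>Q\<close>. Then
  \<open>f\<close> grows at most linearly on large circles and is a polynomial.\<close>

lemma transcendental_scaling_limit:
  assumes f: "transcendental_entire f" and Q: "finite Q" and N: "filterlim N at_top sequentially"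
    and conv: "spherical_lu_conv (UNIV - Q) (\<lambda>k z. f (of_nat (N k) * z) / of_nat (N k)) h"
    and z: "z \<notin> Q"
  shows "h z = None"
proof (rule ccontr)
  assume "h z \<noteq> None"
  let ?g = "\<lambda>k z. f (of_nat (N k) * z) / of_nat (N k)"
  let ?m = "\<lambda>z. chordal_dist (h z) None"
  have hol: "f holomorphic_on UNIV" using f by (simp add: transcendental_entire_def)
  have "(\<lambda>z. f (of_nat n * z)) holomorphic_on UNIV" for n :: nat
    by (rule holomorphic_on_entire_compose[OF hol]) (intro holomorphic_intros)
  then have holg: "?g k holomorphic_on UNIV" for k
    by (cases "N k = 0") (auto intro!: holomorphic_intros)
  have op: "open (UNIV - Q)" using Q by (simp add: finite_imp_closed open_Diff)
  have con: "connected (UNIV - Q)"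
    using Q by (intro connected_open_delete_finite) (auto simp: connected_UNIV)
  have hne: "\<forall>z\<in>UNIV - Q. h z \<noteq> None"
    using spherical_limit_dichotomy[OF holg conv op con]
  proof
    assume "\<forall>z\<in>UNIV - Q. h z = None"
    then show ?thesis using z \<open>h z \<noteq> None\<close> by simp
  qed
  have "infinite ({0<..} - cmod ` Q :: real set)"
    using Q by (intro Diff_infinite_finite) (auto simp: infinite_Ioi)
  then obtain R where R: "R > 0" "R \<notin> cmod ` Q"
    by (metis DiffD1 DiffD2 ex_in_conv finite.emptyI greaterThan_iff)
  have sph: "sphere 0 R \<subseteq> UNIV - Q" using R(2) by force
  have cm: "continuous_on (sphere 0 R) ?m"
    using spherical_limit_continuous[OF holg conv op] sph continuous_on_subset by blast
  have "sphere (0::complex) R \<noteq> {}" using R(1) by simp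
  then obtain z1 where z1: "z1 \<in> sphere 0 R" "\<And>w. w \<in> sphere 0 R \<Longrightarrow> ?m z1 \<le> ?m w"
    using continuous_attains_inf[OF compact_sphere _ cm] by blast
  \<comment> \<open>Half the least distance to infinity on the circle, so that functions within
    \<open>e\<close> of the limit keep a distance above \<open>e\<close>.\<close>
  define e where "e = ?m z1 / 2"
  have "?m z1 \<noteq> 0" using hne z1(1) sph by (auto simp: chordal_dist_infinity_eq_0 simp del: chordal_dist.simps)
  then have e: "e > 0" unfolding e_def using chordal_dist_infinity_nonneg[of "h z1"] by linarith
  have "eventually (\<lambda>k. \<forall>w\<in>sphere 0 R. dist (chordal_dist (Some (?g k w)) None) (?m w) < e) sequentially"
    using uniform_limitD[OF spherical_limit_infinity_dist[OF conv compact_sphere sph] e] .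
  moreover have "eventually (\<lambda>k. N k > 0) sequentially"
    using N[unfolded filterlim_at_top, rule_format, of 1] by eventually_elim simp
  ultimately have ev: "eventually (\<lambda>k. \<forall>w. cmod w = R * real (N k) \<longrightarrow> cmod (f w) \<le> 2 / e * real (N k)) sequentially"
  proof eventually_elim
    case (elim k)
    show ?case
    proof (intro allI impI)
      fix w assume w: "cmod w = R * real (N k)"
      define u where "u = w / of_nat (N k)"
      have u: "u \<in> sphere 0 R" "of_nat (N k) * u = w"
        using w elim(2) by (auto simp: u_def norm_divide)
      define y where "y = ?g k u"
      have "dist (chordal_dist (Some y) None) (?m u) < e" using elim(1) u(1) by (simp only: y_def)
      then have "e < chordal_dist (Some y) None"
        using z1(2)[OF u(1)] unfolding e_def dist_real_def by linarith
      then have "e < 2 / sqrt (1 + (cmod y)\<^sup>2)" by simp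
      moreover have "sqrt (1 + (cmod y)\<^sup>2) > 0" by (simp add: add_pos_nonneg)
      ultimately have "sqrt (1 + (cmod y)\<^sup>2) < 2 / e" using e by (simp add: field_simps)
      moreover have "cmod y \<le> sqrt (1 + (cmod y)\<^sup>2)" by (rule real_le_rsqrt) simp
      ultimately have "cmod y \<le> 2 / e" by linarith
      moreover have "cmod y = cmod (f w) / real (N k)" by (simp add: y_def u(2) norm_divide)
      ultimately show "cmod (f w) \<le> 2 / e * real (N k)"
        using elim(2) by (simp add: field_simps)
    qed
  qed
  have "\<exists>p. \<forall>z. f z = poly p z"
    by (rule entire_linear_growth_on_circles[OF hol R(1) _ N ev]) (use e in simp)
  then show False using f by (simp add: transcendental_entire_def)
qed

lemma infinite_fibre_unbounded:
  assumes "f holomorphic_on UNIV" "\<not> f constant_on UNIV" "infinite {z. f z = c}"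
  shows "\<exists>z. B \<le> cmod z \<and> f z = c"
proof (rule ccontr)
  assume "\<not> ?thesis"
  then have "{z. f z = c} \<subseteq> {z \<in> cball 0 B. f z - c = 0}" by force
  moreover have "finite {z \<in> cball 0 B. f z - c = 0}"
  proof (rule holomorphic_compact_finite_zeros[of "\<lambda>z. f z - c" UNIV])
    show "\<not> (\<lambda>z. f z - c) constant_on UNIV"
      using assms(2) unfolding constant_on_def by (metis diff_add_cancel)
  qed (auto intro!: holomorphic_intros assms(1))
  ultimately show False using assms(3) finite_subset by blast
qed

text \<open>Points over \<open>c\<close> escape to infinity. Dividing them by the ceilings of their
  moduli brings them close to the unit circle along integer scales; one subsequence gives the limit
  \<open>\<zeta>\<close>, a further one the spherical convergence.\<close>

lemma transcendental_scales:
  assumes f: "transcendental_entire f"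
    and qn: "quasi_normal UNIV {(\<lambda>z. f (of_nat n * z) / of_nat n) | n. n \<ge> 1}"
    and c: "infinite {z. f z = c}"
  obtains Q h N w \<zeta> where "finite Q" "filterlim N at_top sequentially" "cmod \<zeta> = 1" "w \<longlonglongrightarrow> \<zeta>"
    "\<And>k. N k \<ge> 1" "\<And>k. f (of_nat (N k) * w k) = c"
    "spherical_lu_conv (UNIV - Q) (\<lambda>k z. f (of_nat (N k) * z) / of_nat (N k)) h"
proof -
  have hol: "f holomorphic_on UNIV" using f by (simp add: transcendental_entire_def)
  note nc = transcendental_not_constant[OF f]
  have "\<forall>j. \<exists>z. real (Suc j) \<le> cmod z \<and> f z = c"
    using infinite_fibre_unbounded[OF hol nc c] by blast
  then obtain Z where Z: "\<And>j. real (Suc j) \<le> cmod (Z j)" "\<And>j. f (Z j) = c" by metis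
  define n where "n j = nat \<lceil>cmod (Z j)\<rceil>" for j
  have n: "cmod (Z j) \<le> real (n j)" "real (n j) < cmod (Z j) + 1" "j < n j" for j
  proof -
    show 1: "cmod (Z j) \<le> real (n j)" "real (n j) < cmod (Z j) + 1"
      using Z(1)[of j] unfolding n_def by linarith+
    show "j < n j" using Z(1)[of j] 1 by linarith
  qed
  define u where "u j = Z j / of_nat (n j)" for j
  have n0: "real (n j) > 0" for j using n(3)[of j] by linarith
  have nu: "of_nat (n j) * u j = Z j" for j using n0[of j] by (simp add: u_def)
  have cu: "cmod (u j) = cmod (Z j) / real (n j)" for j by (simp add: u_def norm_divide)
  have "u j \<in> cball 0 1" for j
    using n(1)[of j] n0[of j] by (simp add: cu divide_le_eq)
  then obtain \<zeta> s where s: "strict_mono s" "(u \<circ> s) \<longlonglongrightarrow> \<zeta>"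
    using compact_cball[of "0::complex" 1, unfolded compact_def, rule_format, of u] by blast
  have low: "1 - 1 / real (Suc j) \<le> cmod (u j)" for j
  proof -
    have "1 - cmod (u j) = (real (n j) - cmod (Z j)) / real (n j)"
      using n0[of j] by (simp add: cu diff_divide_distrib)
    also have "\<dots> \<le> 1 / real (n j)" using n(2)[of j] n0[of j] by (intro divide_right_mono) auto
    also have "\<dots> \<le> 1 / real (Suc j)" using n(3)[of j] by (intro divide_left_mono) auto
    finally show ?thesis by simp
  qed
  have "(\<lambda>j. cmod (u j)) \<longlonglongrightarrow> 1"
  proof (rule tendsto_sandwich[of "\<lambda>j. 1 - 1 / real (Suc j)" _ _ "\<lambda>_. 1"])
    have "(\<lambda>j. 1 / real (Suc j)) \<longlonglongrightarrow> 0" using LIMSEQ_inverse_real_of_nat by (simp add: inverse_eq_divide)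
    then have "(\<lambda>j. 1 - 1 / real (Suc j)) \<longlonglongrightarrow> 1 - 0" by (intro tendsto_intros)
    then show "(\<lambda>j. 1 - 1 / real (Suc j)) \<longlonglongrightarrow> 1" by simp
    show "eventually (\<lambda>j. cmod (u j) \<le> 1) sequentially"
      using \<open>\<And>j. u j \<in> cball 0 1\<close> by simp
  qed (use low in auto)
  then have "(\<lambda>j. cmod (u (s j))) \<longlonglongrightarrow> 1"
    using LIMSEQ_subseq_LIMSEQ[OF _ s(1)] by (simp add: o_def)
  moreover have "(\<lambda>j. cmod (u (s j))) \<longlonglongrightarrow> cmod \<zeta>" using tendsto_norm[OF s(2)] by (simp add: o_def)
  ultimately have \<zeta>: "cmod \<zeta> = 1" using LIMSEQ_unique by blast
  define g where "g k = (\<lambda>z. f (of_nat (n (s k)) * z) / of_nat (n (s k)))" for k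
  have "\<forall>k. g k \<in> {(\<lambda>z. f (of_nat n * z) / of_nat n) | n. n \<ge> 1}"
  proof
    fix k
    have "n (s k) \<ge> 1" using n(3)[of "s k"] by simp
    then show "g k \<in> {(\<lambda>z. f (of_nat n * z) / of_nat n) | n. n \<ge> 1}" unfolding g_def by blast
  qed
  then obtain Q r h where Q: "finite Q" "strict_mono r" "spherical_lu_conv (UNIV - Q) (g \<circ> r) h"
    using qn unfolding quasi_normal_def by blast
  show ?thesis
  proof (rule that[of Q "\<lambda>k. n (s (r k))" \<zeta> "\<lambda>k. u (s (r k))" h])
    show "filterlim (\<lambda>k. n (s (r k))) at_top sequentially"
      unfolding filterlim_at_top
    proof
      fix M
      have "M \<le> n (s (r k))" if "k \<ge> M" for k
        using that n(3)[of "s (r k)"] seq_suble[OF s(1), of "r k"] seq_suble[OF Q(2), of k] by linarith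
      then show "eventually (\<lambda>k. M \<le> n (s (r k))) sequentially"
        unfolding eventually_sequentially by blast
    qed
    show "(\<lambda>k. u (s (r k))) \<longlonglongrightarrow> \<zeta>"
      using LIMSEQ_subseq_LIMSEQ[OF s(2) Q(2)] by (simp add: o_def)
    show "1 \<le> n (s (r k))" for k using n(3)[of "s (r k)"] by simp
    show "f (of_nat (n (s (r k))) * u (s (r k))) = c" for k by (simp add: nu Z(2))
    show "spherical_lu_conv (UNIV - Q) (\<lambda>k z. f (of_nat (n (s (r k))) * z) / of_nat (n (s (r k)))) h"
      using Q(3) by (simp add: g_def o_def)
  qed (fact Q(1) \<zeta>)+
qed

lemma scaling_large_on_compact:
  assumes f: "transcendental_entire f" and Q: "finite Q" and N: "filterlim N at_top sequentially"
    and conv: "spherical_lu_conv (UNIV - Q) (\<lambda>k z. f (of_nat (N k) * z) / of_nat (N k)) h"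
    and K: "compact K" "K \<subseteq> UNIV - Q"
  shows "eventually (\<lambda>k. \<forall>z\<in>K. C \<le> cmod (f (of_nat (N k) * z) / of_nat (N k))) sequentially"
proof -
  let ?g = "\<lambda>k z. f (of_nat (N k) * z) / of_nat (N k)"
  \<comment> \<open>The chordal distance from infinity to points of modulus
    \<open>\<bar>C\<bar>\<close>; closer points have larger modulus.\<close>
  define e where "e = 2 / sqrt (1 + C\<^sup>2)"
  have "sqrt (1 + C\<^sup>2) > 0" by (simp add: add_pos_nonneg)
  then have "e > 0" by (simp add: e_def)
  have "eventually (\<lambda>k. \<forall>z\<in>K. dist (chordal_dist (Some (?g k z)) None) (chordal_dist (h z) None) < e) sequentially"
    using uniform_limitD[OF spherical_limit_infinity_dist[OF conv K] \<open>e > 0\<close>] .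
  then show ?thesis
  proof eventually_elim
    case (elim k)
    show ?case
    proof
      fix z assume z: "z \<in> K"
      define y where "y = ?g k z"
      have hz: "h z = None" using transcendental_scaling_limit[OF f Q N conv] z K(2) by blast
      have "dist (chordal_dist (Some y) None) (chordal_dist (h z) None) < e"
        using elim z by (simp only: y_def)
      then have "2 / sqrt (1 + (cmod y)\<^sup>2) < 2 / sqrt (1 + C\<^sup>2)" by (simp add: hz e_def)
      moreover have "sqrt (1 + (cmod y)\<^sup>2) > 0" by (simp add: add_pos_nonneg)
      ultimately have "sqrt (1 + C\<^sup>2) < sqrt (1 + (cmod y)\<^sup>2)"
        using \<open>sqrt (1 + C\<^sup>2) > 0\<close> by (simp add: field_simps)
      then have "C\<^sup>2 \<le> (cmod y)\<^sup>2" by simp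
      then have "C \<le> cmod y" by (meson norm_ge_zero power2_le_imp_le)
      then show "C \<le> cmod (?g k z)" by (simp only: y_def)
    qed
  qed
qed

section \<open>Choice of the scale\<close>

theorem mainTheorem9:
  fixes f :: "complex \<Rightarrow> complex" and \<delta> :: complex
  assumes "transcendental_entire f"
    and "\<delta> \<noteq> 0"
    and "quasi_normal UNIV {(\<lambda>z. f (of_nat n * z) / of_nat n) | n. n \<ge> 1}"
  shows "htop (UNIV :: (complex \<times> complex) set) (henon_map f \<delta>) = \<infinity>"
proof (rule ereal_top)
  fix B :: real
  \<comment> \<open>Chosen so that \<open>ln M / 3\<close> is at least \<open>B\<close>; 3 is the
    period of the itinerary.\<close>
  define M where "M = nat \<lceil>exp (3 * B)\<rceil>"
  have M: "exp (3 * B) \<le> real M" unfolding M_def by linarith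
  then have "real M > 0" using exp_gt_zero[of "3 * B"] by linarith
  then have "M > 0" by simp
  have "3 * B \<le> ln (real M)" using M \<open>real M > 0\<close> by (simp add: ln_ge_iff)
  obtain c where c: "infinite {z. f z = c}"
    using transcendental_infinite_fibre[OF assms(1)] by blast
  obtain Q h N w \<zeta> where Q: "finite Q" and N: "filterlim N at_top sequentially" and \<zeta>: "cmod \<zeta> = 1"
    and w: "w \<longlonglongrightarrow> \<zeta>" and N1: "\<And>k. N k \<ge> 1" and fw: "\<And>k. f (of_nat (N k) * w k) = c"
    and conv: "spherical_lu_conv (UNIV - Q) (\<lambda>k z. f (of_nat (N k) * z) / of_nat (N k)) h"
    by (rule transcendental_scales[OF assms(1,3) c]) blast
  have hol: "f holomorphic_on UNIV" using assms(1) by (simp add: transcendental_entire_def)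
  note nc = transcendental_not_constant[OF assms(1)]
  \<comment> \<open>The ratio \<open>v / \<rho>\<close> required by \<open>htop_henon_ge\<close>; at
    scale \<open>n\<close> the radii will be \<open>\<rho> = n * r\<close> and
    \<open>v = n * (D * r)\<close>.\<close>
  define D where "D = 2 * (1 + cmod \<delta>)"
  have D: "D \<ge> 2" by (simp add: D_def)
  \<comment> \<open>The excluded radii are those whose circles about 0 or \<open>\<zeta>\<close>
    meet \<open>Q\<close>. The bound \<open>1 / (2 * D)\<close> gives \<open>v < n / 2\<close>,
    hence \<open>2 * v < cmod b = n\<close>.\<close>
  let ?bad = "cmod ` Q \<union> (\<lambda>q. cmod (q - \<zeta>)) ` Q"
  have "infinite ({0<..<1 / (2 * D)} - ?bad)"
    using Q D by (intro Diff_infinite_finite infinite_Ioo) auto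
  then obtain r where r: "r \<in> {0<..<1 / (2 * D)} - ?bad" by (metis ex_in_conv finite.emptyI)
  have r0: "r > 0" "r < 1 / (2 * D)" using r by auto
  have rD: "D * r > 0" "D * r < 1 / 2" using r0 D by (auto simp: field_simps)
  have sphQ: "sphere 0 r \<subseteq> UNIV - Q" "sphere \<zeta> r \<subseteq> UNIV - Q"
    using r by (auto simp: dist_norm norm_minus_commute)
  \<comment> \<open>Since \<open>v < n / 2\<close>, the number \<open>n * C0\<close> exceeds both
    \<open>cmod b + v\<close> and \<open>cmod (\<delta> * b) + v\<close>.\<close>
  define C0 where "C0 = 2 + cmod \<delta>"
  have C0: "C0 \<ge> 2" by (simp add: C0_def)
  \<comment> \<open>\<open>M * M\<close> points, because only the square root survives the count of
    components. They are fixed before the scale, so that a large scale brings them into the small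
    disc about 0.\<close>
  obtain S where S: "finite S" "card S = M * M" "S \<subseteq> {z. f z = c}"
    using infinite_arbitrarily_large[OF c] by blast
  obtain b0 where b0: "\<And>s. s \<in> S \<Longrightarrow> cmod s \<le> b0"
    using finite_imp_bounded[OF S(1)] unfolding bounded_iff by blast
  have Nr: "filterlim (\<lambda>k. real (N k)) at_top sequentially"
    by (rule filterlim_compose[OF filterlim_real_sequentially N])
  have ev1: "eventually (\<lambda>k. x < real (N k)) sequentially" for x
    using Nr by (simp add: filterlim_at_top_dense)
  have ev2: "eventually (\<lambda>k. dist (w k) \<zeta> < r) sequentially"
    using tendstoD[OF w r0(1)] .
  note ev3 = scaling_large_on_compact[OF assms(1) Q N conv compact_sphere sphQ(1), of C0]
  note ev4 = scaling_large_on_compact[OF assms(1) Q N conv compact_sphere sphQ(2), of C0]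
  \<comment> \<open>In this order the conditions place \<open>S\<close> in the disc about 0, put
    \<open>c\<close> in \<open>ball 0 v\<close>, keep its modulus below \<open>n * C0\<close>, put a
    point over \<open>c\<close> in the disc about \<open>b\<close>, and make \<open>f\<close> large
    on both circles.\<close>
  have "eventually (\<lambda>k. b0 / r < real (N k) \<and> cmod c / (D * r) < real (N k) \<and> cmod c < real (N k) \<and> dist (w k) \<zeta> < r \<and>
      (\<forall>z\<in>sphere 0 r. C0 \<le> cmod (f (of_nat (N k) * z) / of_nat (N k))) \<and>
      (\<forall>z\<in>sphere \<zeta> r. C0 \<le> cmod (f (of_nat (N k) * z) / of_nat (N k)))) sequentially"
    by (intro eventually_conj ev1 ev2 ev3 ev4)
  then obtain k where k: "b0 / r < real (N k)" "cmod c / (D * r) < real (N k)" "cmod c < real (N k)"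
      "dist (w k) \<zeta> < r"
      "\<And>z. z \<in> sphere 0 r \<Longrightarrow> C0 \<le> cmod (f (of_nat (N k) * z) / of_nat (N k))"
      "\<And>z. z \<in> sphere \<zeta> r \<Longrightarrow> C0 \<le> cmod (f (of_nat (N k) * z) / of_nat (N k))"
    unfolding eventually_sequentially by blast
  define n where "n = real (N k)"
  have n: "n \<ge> 1" using N1[of k] by (simp add: n_def)
  define b where "b = of_nat (N k) * \<zeta>"
  have cb: "cmod b = n" by (simp add: b_def norm_mult \<zeta> n_def)
  have sph: "n * C0 \<le> cmod (f z)"
    if "z \<in> sphere (of_nat (N k) * a) (n * r)"
      "\<And>z. z \<in> sphere a r \<Longrightarrow> C0 \<le> cmod (f (of_nat (N k) * z) / of_nat (N k))" for a z
  proof -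
    define y where "y = z / of_nat (N k)"
    have z: "z = of_nat (N k) * y" using n by (simp add: y_def n_def)
    have "cmod (of_nat (N k) * a - z) = n * cmod (a - y)"
      unfolding z right_diff_distrib[symmetric] by (simp only: norm_mult norm_of_nat n_def)
    then have "y \<in> sphere a r" using that(1) n by (simp add: dist_norm)
    then have "C0 \<le> cmod (f z / of_nat (N k))" unfolding z by (rule that(2))
    then show ?thesis using n by (simp add: norm_divide n_def field_simps)
  qed
  have nD: "n * (D * r) < n * (1 / 2)" using rD n by (intro mult_strict_left_mono) auto
  have "ereal (ln (real M) / real 3) \<le> htop UNIV (henon_map f \<delta>)"
  proof (rule htop_henon_ge[OF hol nc, of "n * r" "n * (D * r)" \<delta> b "n * C0" S c M "of_nat (N k) * w k"])
    show "0 < n * r" using n r0 by simp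
    show "n * (D * r) = 2 * (1 + cmod \<delta>) * (n * r)" by (simp add: D_def)
    show "2 * (n * (D * r)) < cmod b" using nD by (simp add: cb)
    show "cmod b + n * (D * r) < n * C0"
    proof -
      have "n * 2 \<le> n * C0" using C0 n by (intro mult_left_mono) auto
      then show ?thesis using nD n unfolding cb by linarith
    qed
    show "cmod (\<delta> * b) + n * (D * r) \<le> n * C0"
      using nD n by (simp add: norm_mult cb C0_def algebra_simps)
    show "n * C0 \<le> cmod (f z)" if "z \<in> sphere 0 (n * r)" for z
      using sph[of z 0] that k(5) by simp
    show "n * C0 \<le> cmod (f z)" if "z \<in> sphere b (n * r)" for z
      using sph[of z \<zeta>] that k(6) by (simp add: b_def)
    show "S \<subseteq> ball 0 (n * r)"
    proof
      fix s assume "s \<in> S"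
      then have "cmod s \<le> b0" by (rule b0)
      also have "b0 < n * r" using k(1) r0 by (simp add: n_def pos_divide_less_eq)
      finally show "s \<in> ball 0 (n * r)" by simp
    qed
    show "f s = c" if "s \<in> S" for s using that S(3) by blast
    show "c \<in> ball 0 (n * (D * r))" using k(2) rD by (simp add: n_def pos_divide_less_eq)
    show "M * M \<le> card S" using S(2) by simp
    have "b - of_nat (N k) * w k = of_nat (N k) * (\<zeta> - w k)" by (simp add: b_def algebra_simps)
    then have "dist b (of_nat (N k) * w k) = n * dist (w k) \<zeta>"
      by (simp add: dist_norm norm_mult n_def norm_minus_commute)
    then show "of_nat (N k) * w k \<in> ball b (n * r)" using k(4) n by simp
    have "n * 1 \<le> n * C0" using C0 n by (intro mult_left_mono) auto
    then show "cmod (f (of_nat (N k) * w k)) < n * C0" using k(3) by (simp add: fw n_def)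
  qed (fact S(1) \<open>M > 0\<close>)+
  moreover have "B \<le> ln (real M) / real 3" using \<open>3 * B \<le> ln (real M)\<close> by simp
  ultimately show "ereal B \<le> htop UNIV (henon_map f \<delta>)"
    by (meson ereal_less_eq(3) order_trans)
qed

end
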